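(* Let $(M,Q)$ be a random vector, with arbitrary dependence between $M$ and $Q$, such that $\mathbb{P}(M\ge0,\,Q\ge0)=1$. Assume that $$k(x)=-\log\mathbb{P}(Q>x)\in\mathcal{R}_\alpha,\qquad f(x)=-x\log\mathbb{P}(M\ge1-1/x)\in\mathcal{R}_r\qquad\text{with }\alpha,r>1.$$ Let $r^\ast$ and $\beta$ denote the conjugate numbers to $r$ and $\alpha$, respectively (i.e. $1/r+1/r^\ast=1$, $1/\alpha+1/\beta=1$), and let $\gamma=\beta r^\ast/(\beta r^\ast-1)$. Let $R$ be the perpetuity generated by $(M,Q)$, let $R_{co}$ be the perpetuity generated by the comonotonic random vector with the same marginals as $(M,Q)$, and let $$h_{co}(x):=\inf_{t\ge1}\left\{-t\log\min\left\{\mathbb{P}\left(\frac1{1-M}>t\right),\mathbb{P}\left(Q>\frac xt\right)\right\}\right\}.$$ Then $$\limsup_{x\to\infty}\frac{\log\mathbb{P}(R>x)}{h_{co}(x)}\le-\left(\frac{\gamma}{\gamma-1}\right)^{\gamma-1}$$ and $$\lim_{x\to\infty}\frac{\log\mathbb{P}(R_{co}>x)}{h_{co}(x)}=-\left(\frac{\gamma}{\gamma-1}\right)^{\gamma-1}.$$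
   Context: Regular variation: for $\rho\in\mathbb{R}$, $\mathcal{R}_\rho$ is the class of positive measurable functions $g$ defined in a neighbourhood of $+\infty$ with $\lim_{x\to\infty}g(tx)/g(x)=t^\rho$ for all $t>0$. Comonotonicity: a random vector $(X,Y)$ with marginal distribution functions $F_X,F_Y$ is comonotonic if its joint distribution function is $\min\{F_X(x),F_Y(y)\}$; equivalently $(X,Y)\stackrel{d}{=}(F_X^{-1}(U),F_Y^{-1}(U))$ with $U$ uniform on $[0,1]$ and $F^{-1}(u)=\inf\{y\in\mathbb{R}:F(y)\ge u\}$. Perpetuity: the perpetuity $R$ generated by $(M,Q)$ is the (unique in law) random variable satisfying $R\stackrel{d}{=}MR+Q$ with $R$ and $(M,Q)$ independent on the right-hand side; equivalently $R\stackrel{d}{=}\sum_{j=1}^\infty Q_j\prod_{k=1}^{j-1}M_k$, where $(M_n,Q_n)_{n\ge1}$ are i.i.d. copies of $(M,Q)$. *)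

theory Defs
  imports "HOL-Probability.Probability"
begin

definition regularly_varying :: "real \<Rightarrow> (real \<Rightarrow> real) \<Rightarrow> bool" where
  "regularly_varying \<rho> g \<longleftrightarrow>
     (\<exists>x0. g \<in> borel_measurable (restrict_space borel {x0..}) \<and> (\<forall>x\<ge>x0. g x > 0)) \<and>
     (\<forall>t>0. ((\<lambda>x. g (t * x) / g x) \<longlongrightarrow> t powr \<rho>) at_top)"

definition comonotonic :: "'a measure \<Rightarrow> ('a \<Rightarrow> real) \<Rightarrow> ('a \<Rightarrow> real) \<Rightarrow> bool" where
  "comonotonic \<Omega> X Y \<longleftrightarrow>
     X \<in> borel_measurable \<Omega> \<and> Y \<in> borel_measurable \<Omega> \<and>
     (\<forall>x y. \<P>(\<omega> in \<Omega>. X \<omega> \<le> x \<and> Y \<omega> \<le> y) =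
        min (cdf (distr \<Omega> borel X) x) (cdf (distr \<Omega> borel Y) y))"

text \<open>
  The random variable \<open>R\<close>, living on the probability space \<open>\<Omega>'\<close>, solves \<open>R = M R + Q\<close> in
  distribution, with \<open>R\<close> and \<open>(M, Q)\<close> independent on the right-hand side. The independence is
  expressed by evaluating the right-hand side on the product space of \<open>\<Omega>\<close> and \<open>\<Omega>'\<close>.
\<close>
definition is_perpetuity ::
  "'a measure \<Rightarrow> ('a \<Rightarrow> real) \<Rightarrow> ('a \<Rightarrow> real) \<Rightarrow> 'b measure \<Rightarrow> ('b \<Rightarrow> real) \<Rightarrow> bool" where
  "is_perpetuity \<Omega> M Q \<Omega>' R \<longleftrightarrow>
     R \<in> borel_measurable \<Omega>' \<and>
     distr \<Omega>' borel R = distr (\<Omega> \<Otimes>\<^sub>M \<Omega>') borel (\<lambda>(\<omega>, \<omega>'). M \<omega> * R \<omega>' + Q \<omega>)"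

text \<open>
  Two totalised operations occur below: \<open>1 / 0 = 0\<close> and \<open>ln 0 = 0\<close>. They do not matter when
  \<open>- ln (\<P>(Q > x))\<close> and \<open>- x * ln (\<P>(M \<ge> 1 - 1 / x))\<close> are regularly varying, the latter
  with index greater than 1: then \<open>M < 1\<close> almost surely, and since regularly varying functions
  are eventually positive, both probabilities in the minimum are positive for all
  \<open>x\<close> and all \<open>t \<ge> 1\<close>. The infimum is over a nonempty set of nonnegative reals.
\<close>
definition h_co :: "'a measure \<Rightarrow> ('a \<Rightarrow> real) \<Rightarrow> ('a \<Rightarrow> real) \<Rightarrow> real \<Rightarrow> real" where
  "h_co \<Omega> M Q x =
     (INF t\<in>{1..}. - t * ln (min (\<P>(\<omega> in \<Omega>. 1 / (1 - M \<omega>) > t)) (\<P>(\<omega> in \<Omega>. Q \<omega> > x / t))))"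

end

theory Submission
  imports Defs
begin

text \<open>
  Write \<open>T = 1 / (1 - M)\<close>, \<open>k = - ln P(Q > \<cdot>)\<close> and \<open>m = - ln P(T > \<cdot>)\<close>, and call minus the logarithm of
  a probability a cost. A step of the recursion \<open>y \<mapsto> M y + Q\<close> with \<open>T > t\<close> and \<open>Q > q\<close> costs at least
  \<open>max (m t) (k q)\<close>, and exactly that much when \<open>M\<close> and \<open>Q\<close> are comonotonic. With \<open>z = q t\<close> such a
  step moves \<open>y\<close> to \<open>y + (z - y) / t\<close>, and \<open>h_co z\<close> is the infimum of \<open>t * max (m t) (k q)\<close> over all
  factorisations of \<open>z\<close>. Progress at level \<open>y\<close> therefore costs at least \<open>h_co z / (z - y)\<close> per unit
  length, for some \<open>z > y\<close>.

  The function \<open>h_co\<close> is regularly varying of index \<open>\<gamma> > 1\<close>, and on the scale of \<open>y\<close> it behaves like a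
  power: the minimum over \<open>z\<close> of \<open>z powr \<gamma> / (z - y)\<close> is attained at \<open>z = \<zeta> y\<close> with
  \<open>\<zeta> = \<gamma> / (\<gamma> - 1)\<close>, and equals the derivative of \<open>c y powr \<gamma>\<close> with \<open>c = \<zeta> powr (\<gamma> - 1)\<close>. Integrating from
  \<open>0\<close> to \<open>x\<close> gives the total cost \<open>c h_co x\<close>.

  For the upper bound this heuristic becomes a Lyapunov function: \<open>potential_increment\<close> shows that
  an increase of a slightly reduced version of \<open>c h_co\<close> in a single step is covered by the cost of
  that step. Since \<open>exp\<close> of a fraction of the cost has a finite mean under any coupling of \<open>M\<close> and
  \<open>Q\<close> (\<open>exp_moment_log_tail\<close>), the exponential of the potential contracts in mean
  (\<open>potential_contraction\<close>), and the fixed-point equation bounds the stationary tail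
  (\<open>perpetuity_band\<close>, \<open>perpetuity_tail_le\<close>).

  For the lower bound the optimal strategy is played: to get from \<open>l x\<close> to \<open>x\<close>, repeat the
  near-optimal step for \<open>z = \<zeta> x\<close> as often as necessary (\<open>climb\<close>). This yields a recursion between
  the log-tail of \<open>R\<close> at \<open>x\<close> and at \<open>l x\<close>, which bounds the log-tail by a multiple of \<open>h_co\<close>; the factor tends to \<open>c\<close> as \<open>l\<close> increases to \<open>1\<close>
  (\<open>climbing_cost\<close>).
\<close>

section \<open>Regularly varying monotone functions\<close>

lemma regularly_varying_eventually_pos:
  assumes "regularly_varying \<rho> g"
  shows "\<forall>\<^sub>F x in at_top. 0 < g x"
  using assms unfolding regularly_varying_def eventually_at_top_linorder by blast

lemma regularly_varying_eventually_le:
  assumes "regularly_varying \<rho> g" "0 < s" "s powr \<rho> < b"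
  shows "\<forall>\<^sub>F x in at_top. g (s * x) \<le> b * g x"
proof -
  have "((\<lambda>x. g (s * x) / g x) \<longlongrightarrow> s powr \<rho>) at_top"
    using assms(1,2) by (simp add: regularly_varying_def)
  from order_tendstoD(2)[OF this assms(3)] regularly_varying_eventually_pos[OF assms(1)]
  show ?thesis
    by eventually_elim (simp add: divide_simps)
qed

lemma regularly_varying_eventually_ge:
  assumes "regularly_varying \<rho> g" "0 < s" "b < s powr \<rho>"
  shows "\<forall>\<^sub>F x in at_top. b * g x \<le> g (s * x)"
proof -
  have "((\<lambda>x. g (s * x) / g x) \<longlongrightarrow> s powr \<rho>) at_top"
    using assms(1,2) by (simp add: regularly_varying_def)
  from order_tendstoD(1)[OF this assms(3)] regularly_varying_eventually_pos[OF assms(1)]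
  show ?thesis
    by eventually_elim (simp add: divide_simps mult.commute)
qed

lemma eventually_at_top_scale:
  fixes s :: real
  assumes "0 < s" "\<forall>\<^sub>F x in at_top. P x"
  shows "\<forall>\<^sub>F x in at_top. P (s * x)"
proof -
  have "filterlim (\<lambda>x. s * x) at_top at_top"
    using assms(1) by (intro filterlim_tendsto_pos_mult_at_top[OF tendsto_const] filterlim_ident)
  then show ?thesis using assms(2) by (auto simp: filterlim_iff)
qed

text \<open>
  Upper bounds for all scale factors are enough, because the lower bound for the factor \<open>s\<close> is the
  upper bound for \<open>1 / s\<close>, read at \<open>s * x\<close>.
\<close>
lemma regularly_varying_monoI:
  fixes g :: "real \<Rightarrow> real"
  assumes mono: "mono g" and pos: "\<forall>\<^sub>F x in at_top. 0 < g x"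
    and le: "\<And>s \<epsilon>. 0 < s \<Longrightarrow> 0 < \<epsilon> \<Longrightarrow> \<forall>\<^sub>F x in at_top. g (s * x) \<le> (1 + \<epsilon>) * s powr \<rho> * g x"
  shows "regularly_varying \<rho> g"
  unfolding regularly_varying_def
proof (intro conjI allI impI)
  obtain x0 where "\<forall>x\<ge>x0. 0 < g x"
    using pos by (auto simp: eventually_at_top_linorder)
  moreover have "g \<in> borel_measurable (restrict_space borel {x0..})"
    using borel_measurable_mono[OF mono] by (rule measurable_restrict_space1)
  ultimately show "\<exists>x0. g \<in> borel_measurable (restrict_space borel {x0..}) \<and> (\<forall>x\<ge>x0. 0 < g x)"
    by blast
next
  fix s :: real assume s: "0 < s"
  then have sp: "0 < s powr \<rho>" by simp
  show "((\<lambda>x. g (s * x) / g x) \<longlongrightarrow> s powr \<rho>) at_top"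
  proof (rule order_tendstoI)
    fix b assume b: "s powr \<rho> < b"
    define \<epsilon> where "\<epsilon> = (b / s powr \<rho> - 1) / 2"
    have e: "0 < \<epsilon>" using b sp by (simp add: \<epsilon>_def field_simps)
    have "(1 + \<epsilon>) * s powr \<rho> = (b + s powr \<rho>) / 2"
      using s sp unfolding \<epsilon>_def by (simp add: field_simps)
    then have *: "(1 + \<epsilon>) * s powr \<rho> < b" using b by simp
    show "\<forall>\<^sub>F x in at_top. g (s * x) / g x < b"
      using le[OF s e] pos
    proof eventually_elim
      case (elim x)
      have "g (s * x) / g x \<le> (1 + \<epsilon>) * s powr \<rho>"
        using elim by (simp add: pos_divide_le_eq)
      then show ?case using * by linarith
    qed
  next
    fix b assume b: "b < s powr \<rho>"
    define b' where "b' = max b (s powr \<rho> / 2)"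
    define \<epsilon> where "\<epsilon> = (s powr \<rho> / b' - 1) / 2"
    have b': "0 < b'" "b' < s powr \<rho>" "b \<le> b'" using b sp by (auto simp: b'_def less_max_iff_disj)
    then have e: "0 < \<epsilon>" by (simp add: \<epsilon>_def field_simps)
    have "(1 + \<epsilon>) * b' = (b' + s powr \<rho>) / 2"
      using b' unfolding \<epsilon>_def by (simp add: field_simps)
    then have *: "(1 + \<epsilon>) * b' < s powr \<rho>" using b' by simp
    have inv: "(1 / s) powr \<rho> = 1 / s powr \<rho>" using s by (simp add: powr_divide)
    have "\<forall>\<^sub>F x in at_top. g (1 / s * (s * x)) \<le> (1 + \<epsilon>) * (1 / s) powr \<rho> * g (s * x)"
      by (rule eventually_at_top_scale[OF s]) (rule le, use s e in auto)
    then show "\<forall>\<^sub>F x in at_top. b < g (s * x) / g x"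
      using pos
    proof eventually_elim
      case (elim x)
      have "s powr \<rho> * g x \<le> (1 + \<epsilon>) * g (s * x)"
        using elim(1) s sp unfolding inv by (simp add: field_simps)
      moreover have "(1 + \<epsilon>) * b' * g x < s powr \<rho> * g x" using * elim(2) by simp
      ultimately have "(1 + \<epsilon>) * (b' * g x) < (1 + \<epsilon>) * g (s * x)" by (simp add: mult.assoc)
      then have "b' * g x < g (s * x)" using e by (simp add: mult_less_cancel_left)
      then have "b' < g (s * x) / g x" using elim(2) by (simp add: pos_less_divide_eq)
      then show ?case using b' by linarith
    qed
  qed
qed

lemma regularly_varying_iterate:
  assumes rv: "regularly_varying \<rho> g" and \<kappa>: "0 \<le> \<kappa>" "\<kappa> < 2 powr \<rho>"
  shows "\<forall>\<^sub>F x in at_top. \<forall>n. \<kappa> ^ n * g x \<le> g (2 ^ n * x)"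
proof -
  obtain N where N: "\<And>x. N \<le> x \<Longrightarrow> \<kappa> * g x \<le> g (2 * x)"
    using regularly_varying_eventually_ge[OF rv _ \<kappa>(2)] by (auto simp: eventually_at_top_linorder)
  have "\<kappa> ^ n * g x \<le> g (2 ^ n * x)" if x: "max N 1 \<le> x" for x n
  proof (induction n)
    case (Suc n)
    have "N \<le> x" "1 * x \<le> 2 ^ n * x" using x by (auto intro!: mult_right_mono)
    then have "\<kappa> * g (2 ^ n * x) \<le> g (2 ^ Suc n * x)" using N[of "2 ^ n * x"] by (simp add: mult.assoc)
    moreover have "\<kappa> * (\<kappa> ^ n * g x) \<le> \<kappa> * g (2 ^ n * x)"
      by (rule mult_left_mono[OF Suc \<kappa>(1)])
    ultimately show ?case by (simp add: mult.assoc)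
  qed simp
  then show ?thesis by (intro eventually_at_top_linorderI[of "max N 1"]) simp
qed

lemma regularly_varying_unbounded:
  assumes rv: "regularly_varying \<rho> g" and "0 < \<rho>"
  shows "\<exists>x\<ge>a. C \<le> g x"
proof -
  have two: "1 < (2::real) powr \<rho>" using \<open>0 < \<rho>\<close> by (simp add: gr_one_powr)
  define \<kappa> where "\<kappa> = (1 + 2 powr \<rho>) / 2"
  have \<kappa>: "1 < \<kappa>" "\<kappa> < 2 powr \<rho>" using two by (auto simp: \<kappa>_def)
  have "\<forall>\<^sub>F x in at_top. max a 0 \<le> x \<and> 0 < g x \<and> (\<forall>n. \<kappa> ^ n * g x \<le> g (2 ^ n * x))"
    using \<kappa> by (intro eventually_conj eventually_ge_at_top
      regularly_varying_eventually_pos[OF rv] regularly_varying_iterate[OF rv]) auto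
  then obtain x where x: "max a 0 \<le> x" "0 < g x" "\<And>n. \<kappa> ^ n * g x \<le> g (2 ^ n * x)"
    by (auto simp: eventually_at_top_linorder)
  obtain n where n: "C / g x < \<kappa> ^ n" using real_arch_pow[OF \<kappa>(1)] by blast
  have "C \<le> g (2 ^ n * x)" using n x(2) x(3)[of n] by (simp add: pos_divide_less_eq)
  moreover have "1 * x \<le> 2 ^ n * x" using x by (intro mult_right_mono) auto
  then have "a \<le> 2 ^ n * x" using x by linarith
  ultimately show ?thesis by blast
qed

lemma regularly_varying_at_top:
  assumes mono: "mono g" and rv: "regularly_varying \<rho> g" and "0 < \<rho>"
  shows "filterlim g at_top at_top"
  unfolding filterlim_at_top
proof
  fix C :: real
  obtain x where "C \<le> g x" using regularly_varying_unbounded[OF rv \<open>0 < \<rho>\<close>] by blast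
  then have "C \<le> g y" if "x \<le> y" for y using monoD[OF mono that] by linarith
  then show "\<forall>\<^sub>F x in at_top. C \<le> g x" by (auto simp: eventually_at_top_linorder)
qed

lemma regularly_varying_divide_ident:
  assumes "regularly_varying \<rho> g"
  shows "regularly_varying (\<rho> - 1) (\<lambda>x. g x / x)"
proof -
  obtain x0 where g: "g \<in> borel_measurable (restrict_space borel {x0..})" "\<And>x. x0 \<le> x \<Longrightarrow> 0 < g x"
    using assms unfolding regularly_varying_def by blast
  show ?thesis
    unfolding regularly_varying_def
  proof (intro conjI allI impI exI[of _ "max x0 1"])
    have "g \<in> borel_measurable (restrict_space borel {max x0 1..})"
      by (rule measurable_restrict_mono[OF g(1)]) auto
    then show "(\<lambda>x. g x / x) \<in> borel_measurable (restrict_space borel {max x0 1..})"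
      by (rule borel_measurable_divide) (rule measurable_restrict_space1, rule measurable_ident_sets[OF refl])
    show "0 < g x / x" if "max x0 1 \<le> x" for x using that g(2)[of x] by simp
    fix t :: real assume t: "0 < t"
    then have "((\<lambda>x. g (t * x) / g x) \<longlongrightarrow> t powr \<rho>) at_top"
      using assms by (simp add: regularly_varying_def)
    then have "((\<lambda>x. g (t * x) / g x / t) \<longlongrightarrow> t powr \<rho> / t) at_top"
      using t by (intro tendsto_divide) auto
    moreover have "\<forall>\<^sub>F x in at_top. g (t * x) / g x / t = g (t * x) / (t * x) / (g x / x)"
      using eventually_gt_at_top[of 0] by eventually_elim (use t in \<open>simp add: field_simps\<close>)
    ultimately have "((\<lambda>x. g (t * x) / (t * x) / (g x / x)) \<longlongrightarrow> t powr \<rho> / t) at_top"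
      by (rule Lim_transform_eventually)
    moreover have "t powr \<rho> / t = t powr (\<rho> - 1)" using t by (simp add: powr_diff)
    ultimately show "((\<lambda>x. g (t * x) / (t * x) / (g x / x)) \<longlongrightarrow> t powr (\<rho> - 1)) at_top"
      by simp
  qed
qed

text \<open>
  For a monotone function, the pointwise limits on a fine geometric grid already give a lower bound
  that is uniform on compact sets.
\<close>
lemma regularly_varying_uniform_ge:
  assumes mono: "mono g" and rv: "regularly_varying \<rho> g" and "0 < \<rho>"
    and a: "0 < a" and \<kappa>: "0 < \<kappa>" "\<kappa> < 1"
  shows "\<forall>\<^sub>F x in at_top. \<forall>w\<in>{a..b}. \<kappa> * w powr \<rho> * g x \<le> g (w * x)"
proof -
  define p where "p = (1 / \<kappa>) powr (1 / (2 * \<rho>))"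
  have p1: "1 < p" unfolding p_def using \<kappa> \<open>0 < \<rho>\<close> by (intro gr_one_powr) auto
  have "p powr \<rho> = (1 / \<kappa>) powr (1 / 2)" using \<open>0 < \<rho>\<close> by (simp add: p_def powr_powr)
  also have "\<dots> < (1 / \<kappa>) powr 1" using \<kappa> by (intro powr_less_mono) auto
  finally have p\<rho>: "\<kappa> * p powr \<rho> < 1" using \<kappa> by (simp add: field_simps)
  have "\<forall>\<^sub>F x in at_top. \<forall>w\<in>{a..a * p ^ n}. \<kappa> * w powr \<rho> * g x \<le> g (w * x)" for n
  proof (induction n)
    case 0
    have "\<forall>\<^sub>F x in at_top. (\<kappa> * a powr \<rho>) * g x \<le> g (a * x)"
      using a \<kappa> by (intro regularly_varying_eventually_ge[OF rv]) auto
    then show ?case by simp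
  next
    case (Suc n)
    define d where "d = a * p ^ n"
    have d: "0 < d" using a p1 by (simp add: d_def)
    have "\<forall>\<^sub>F x in at_top. (\<kappa> * p powr \<rho> * d powr \<rho>) * g x \<le> g (d * x)"
      using d p\<rho> by (intro regularly_varying_eventually_ge[OF rv]) auto
    then show ?case
      using Suc regularly_varying_eventually_pos[OF rv] eventually_gt_at_top[of 0]
    proof eventually_elim
      case (elim x)
      show ?case
      proof
        fix w assume w: "w \<in> {a..a * p ^ Suc n}"
        show "\<kappa> * w powr \<rho> * g x \<le> g (w * x)"
        proof (cases "w \<le> d")
          case True
          then show ?thesis using elim(2) w by (simp add: d_def)
        next
          case False
          have "w powr \<rho> \<le> (p * d) powr \<rho>"
            using w a \<open>0 < \<rho>\<close> by (intro powr_mono2) (auto simp: d_def ac_simps)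
          also have "\<dots> = p powr \<rho> * d powr \<rho>" using p1 d by (simp add: powr_mult)
          finally have "\<kappa> * w powr \<rho> * g x \<le> \<kappa> * (p powr \<rho> * d powr \<rho>) * g x"
            using \<kappa> elim by (intro mult_right_mono mult_left_mono) auto
          also have "\<dots> \<le> g (d * x)" using elim(1) by (simp add: mult.assoc)
          also have "\<dots> \<le> g (w * x)" using False elim by (intro monoD[OF mono] mult_right_mono) auto
          finally show ?thesis .
        qed
      qed
    qed
  qed
  moreover obtain n where "b / a < p ^ n" using real_arch_pow[OF p1] by blast
  then have "{a..b} \<subseteq> {a..a * p ^ n}" using a by (auto simp: field_simps)
  ultimately show ?thesis
    by (blast intro: eventually_mono)
qed

text \<open>
  Iterated doubling is used here in place of Potter's bounds: an index above \<open>1\<close> beats any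
  linear function uniformly, not only on compact sets of \<open>w\<close>.
\<close>
lemma regularly_varying_superlinear:
  assumes mono: "mono g" and rv: "regularly_varying \<rho> g" and "1 < \<rho>"
  shows "\<exists>K\<ge>1. \<forall>\<^sub>F x in at_top. \<forall>w\<ge>K. L * w * g x \<le> g (w * x)"
proof -
  define K where "K = (4 * max L 1) powr (1 / (\<rho> - 1))"
  have K1: "1 \<le> K" unfolding K_def using \<open>1 < \<rho>\<close> by (intro ge_one_powr_ge_zero) auto
  have "K powr (\<rho> - 1) = 4 * max L 1" using \<open>1 < \<rho>\<close> by (simp add: K_def powr_powr)
  moreover have "K powr \<rho> = K * K powr (\<rho> - 1)" using K1 by (simp add: powr_mult_base)
  moreover have "K * (2 * max L 1) < K * (4 * max L 1)" using K1 by (intro mult_strict_left_mono) auto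
  ultimately have K\<rho>: "2 * K * max L 1 < K powr \<rho>" by simp
  have A: "\<forall>\<^sub>F x in at_top. 2 * K * max L 1 * g x \<le> g (K * x)"
    using K1 K\<rho> by (intro regularly_varying_eventually_ge[OF rv]) auto
  have "(2::real) powr 1 < 2 powr \<rho>" using \<open>1 < \<rho>\<close> by (intro powr_less_mono) auto
  then have "\<forall>\<^sub>F x in at_top. \<forall>n. 2 ^ n * g x \<le> g (2 ^ n * x)"
    by (intro regularly_varying_iterate[OF rv]) auto
  then have B: "\<forall>\<^sub>F x in at_top. \<forall>n. 2 ^ n * g (K * x) \<le> g (2 ^ n * (K * x))"
    using K1 by (intro eventually_at_top_scale[of K "\<lambda>x. \<forall>n. 2 ^ n * g x \<le> g (2 ^ n * x)"]) auto
  have "\<forall>\<^sub>F x in at_top. \<forall>w\<ge>K. L * w * g x \<le> g (w * x)"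
    using A B regularly_varying_eventually_pos[OF rv] eventually_gt_at_top[of 0]
  proof eventually_elim
    case (elim x)
    show ?case
    proof (intro allI impI)
      fix w assume w: "K \<le> w"
      define n where "n = nat \<lfloor>log 2 (w / K)\<rfloor>"
      have wK: "1 \<le> w / K" using w K1 by simp
      then have "real n = of_int \<lfloor>log 2 (w / K)\<rfloor>" unfolding n_def by (simp add: zero_le_log_cancel_iff)
      then have n: "real n \<le> log 2 (w / K)" "log 2 (w / K) < real n + 1" by linarith+
      have "2 ^ n \<le> w / K" using n(1) wK by (simp add: le_log_iff powr_realpow)
      then have n1: "2 ^ n * K \<le> w" using K1 by (simp add: field_simps)
      have "log 2 (w / K) < real (Suc n)" using n(2) by simp
      then have "w / K < 2 ^ Suc n" using wK by (subst (asm) log_less_iff) (auto simp: powr_add powr_realpow)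
      then have n2: "w \<le> 2 ^ n * (2 * K)" using K1 by (simp add: field_simps)
      have "L * w * g x \<le> max L 1 * w * g x"
        using w K1 elim by (intro mult_right_mono) auto
      also have "\<dots> \<le> max L 1 * (2 ^ n * (2 * K)) * g x"
        using n2 elim by (intro mult_right_mono mult_left_mono) auto
      also have "\<dots> = 2 ^ n * (2 * K * max L 1 * g x)" by simp
      also have "\<dots> \<le> 2 ^ n * g (K * x)" using elim(1) by (intro mult_left_mono) auto
      also have "\<dots> \<le> g (2 ^ n * (K * x))" using elim(2) by blast
      also have "\<dots> \<le> g (w * x)" using n1 elim(4)
        by (intro monoD[OF mono]) (simp add: mult.assoc[symmetric])
      finally show "L * w * g x \<le> g (w * x)" .
    qed
  qed
  then show ?thesis using K1 by blast
qed

lemma powr_ge_tangent: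
  fixes u v p :: real
  assumes "0 \<le> u" "0 < v" "1 \<le> p"
  shows "v powr p + p * v powr (p - 1) * (u - v) \<le> u powr p"
proof (cases "u = 0")
  case True
  have "v powr p = v * v powr (p - 1)" using assms by (simp add: powr_mult_base)
  then have "v powr p + p * v powr (p - 1) * (u - v) = (1 - p) * v powr p"
    using True by (simp add: algebra_simps)
  also have "\<dots> \<le> 0" using assms by (simp add: mult_nonpos_nonneg)
  finally show ?thesis by (simp add: True assms)
next
  case False
  have "v powr p + p * v powr (p - 1) * (u - v) \<le> u powr p" if "0 < u"
  proof -
    have "(p * v powr (p - 1)) * (u - v) \<le> u powr p - v powr p"
    proof (rule convex_on_imp_above_tangent[where A = "{0<..}"])
      show "convex_on {0<..} (\<lambda>x. x powr p)"
        by (rule powr_convex[OF assms(3)])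
      show "((\<lambda>x. x powr p) has_real_derivative p * v powr (p - 1)) (at v within {0<..})"
        by (rule has_field_derivative_at_within[OF has_real_derivative_powr[OF assms(2)]])
    qed (simp_all add: assms that interior_open)
    then show ?thesis by simp
  qed
  then show ?thesis using False assms by simp
qed

section \<open>The rate function of a pair of log-tails\<close>

text \<open>
  The functions \<open>k\<close> and \<open>m\<close> stand for the log-tails of \<open>Q\<close> and of \<open>1 / (1 - M)\<close>, so that \<open>\<rho>\<close> is
  \<open>r - 1\<close>, and \<open>h\<close> below is \<open>h_co\<close>.
\<close>
locale growth_pair =
  fixes k m :: "real \<Rightarrow> real" and \<alpha> \<rho> \<gamma> :: real
  assumes mono_k: "mono k" and mono_m: "mono m"
    and k_nonneg: "0 \<le> k x" and m_nonneg: "0 \<le> m x"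
    and rv_k: "regularly_varying \<alpha> k" and rv_m: "regularly_varying \<rho> m"
    and \<alpha>: "1 < \<alpha>" and \<rho>: "0 < \<rho>"
    and \<gamma>: "\<gamma> = \<alpha> * (\<rho> + 1) / (\<alpha> + \<rho>)"
begin

definition cost :: "real \<Rightarrow> real \<Rightarrow> real" where
  "cost x t = t * max (m t) (k (x / t))"

definition h :: "real \<Rightarrow> real" where
  "h x = (INF t\<in>{1..}. cost x t)"

lemma \<gamma>_gt_1: "1 < \<gamma>"
proof -
  have "\<alpha> + \<rho> < \<alpha> * (\<rho> + 1)" using \<alpha> \<rho> by (simp add: algebra_simps)
  then show ?thesis using \<alpha> \<rho> by (simp add: \<gamma>)
qed

lemma k_at_top: "filterlim k at_top at_top"
  using \<alpha> by (intro regularly_varying_at_top[OF mono_k rv_k]) simp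

lemma m_at_top: "filterlim m at_top at_top"
  by (rule regularly_varying_at_top[OF mono_m rv_m \<rho>])

lemma eventually_k_ge: "\<forall>\<^sub>F x in at_top. C \<le> k x"
  using k_at_top by (simp add: filterlim_at_top)

lemma eventually_m_ge: "\<forall>\<^sub>F x in at_top. C \<le> m x"
  using m_at_top by (simp add: filterlim_at_top)

lemma cost_nonneg: "1 \<le> t \<Longrightarrow> 0 \<le> cost x t"
  using m_nonneg[of t] by (simp add: cost_def le_max_iff_disj)

lemma bdd_below_cost: "bdd_below (cost x ` {1..})"
  using cost_nonneg by (intro bdd_belowI2[of _ 0]) auto

lemma h_le_cost: "1 \<le> t \<Longrightarrow> h x \<le> cost x t"
  unfolding h_def by (intro cINF_lower[OF bdd_below_cost]) auto

lemma h_le: "1 \<le> t \<Longrightarrow> h (q * t) \<le> t * max (m t) (k q)"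
  using h_le_cost[of t "q * t"] by (simp add: cost_def)

lemma h_nonneg: "0 \<le> h x"
  unfolding h_def by (intro cINF_greatest) (auto simp: cost_nonneg)

lemma h_mono: "mono h"
proof (rule monoI)
  fix x y :: real assume xy: "x \<le> y"
  show "h x \<le> h y"
    unfolding h_def[of y]
  proof (rule cINF_greatest)
    fix t :: real assume t: "t \<in> {1..}"
    have "k (x / t) \<le> k (y / t)"
      using t xy by (intro monoD[OF mono_k] divide_right_mono) auto
    then have "cost x t \<le> cost y t"
      unfolding cost_def using t by (intro mult_left_mono max.mono) auto
    then show "h x \<le> cost y t" using h_le_cost[of t x] t by simp
  qed simp
qed

lemma near_minimiser_exists:
  assumes "0 < h x" "0 < \<eta>"
  shows "\<exists>t\<ge>1. cost x t < (1 + \<eta>) * h x"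
proof -
  have "Inf (cost x ` {1..}) < (1 + \<eta>) * h x"
    using assms unfolding h_def[symmetric] by simp
  then obtain y where "y \<in> cost x ` {1..}" "y < (1 + \<eta>) * h x"
    using cInf_lessD[of "cost x ` {1..}"] by auto
  then show ?thesis by auto
qed

lemma h_at_top: "filterlim h at_top at_top"
  unfolding filterlim_at_top
proof
  fix C :: real
  have "\<forall>\<^sub>F t in at_top. 1 \<le> t \<and> max C 0 \<le> m t"
    by (intro eventually_conj eventually_ge_at_top eventually_m_ge)
  then obtain T where T: "1 \<le> T" "max C 0 \<le> m T" by (auto simp: eventually_at_top_linorder)
  have "\<forall>\<^sub>F x in at_top. max C 0 \<le> k x"
    by (rule eventually_k_ge)
  then have "\<forall>\<^sub>F x in at_top. max C 0 \<le> k (1 / T * x)"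
    using T by (intro eventually_at_top_scale[of "1 / T" "\<lambda>x. max C 0 \<le> k x"]) auto
  then show "\<forall>\<^sub>F x in at_top. C \<le> h x"
    using eventually_ge_at_top[of 0]
  proof eventually_elim
    case (elim x)
    show ?case
      unfolding h_def
    proof (rule cINF_greatest)
      fix t :: real assume t: "t \<in> {1..}"
      have "max C 0 \<le> max (m t) (k (x / t))"
      proof (cases "t \<le> T")
        case True
        have "max C 0 \<le> k (x / T)" using elim(1) by simp
        also have "\<dots> \<le> k (x / t)"
          using True t elim by (intro monoD[OF mono_k] divide_left_mono) auto
        finally show ?thesis by (rule max.coboundedI2)
      next
        case False
        then have "m T \<le> m t" by (intro monoD[OF mono_m]) simp
        then show ?thesis using T by (intro max.coboundedI1) linarith
      qed
      then have "C \<le> 1 * max (m t) (k (x / t))" by simp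
      also have "\<dots> \<le> cost x t"
        unfolding cost_def using t m_nonneg[of t] by (intro mult_right_mono) (auto simp: le_max_iff_disj)
      finally show "C \<le> cost x t" .
    qed simp
  qed
qed

lemma eventually_h_ge: "\<forall>\<^sub>F x in at_top. C \<le> h x"
  using h_at_top by (simp add: filterlim_at_top)

lemma eventually_h_pos: "\<forall>\<^sub>F x in at_top. 0 < h x"
  using eventually_h_ge[of 1] by eventually_elim simp

text \<open>
  The index \<open>\<alpha> > 1\<close> makes \<open>t * k (x / t)\<close> decrease in \<open>t\<close>, so that a bounded \<open>t\<close> is never close
  to optimal; and \<open>t * m t\<close> increases at least linearly, so that \<open>x / t\<close> cannot stay bounded
  either. Hence \<open>h\<close> only depends on the behaviour of \<open>k\<close> and \<open>m\<close> at infinity.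
\<close>
lemma near_minimisers_large:
  "\<forall>\<^sub>F x in at_top. \<forall>t\<ge>1. cost x t \<le> 2 * h x \<longrightarrow> T \<le> t \<and> T \<le> x / t"
proof -
  define T1 where "T1 = max 1 T"
  have T1: "1 \<le> T1" "T \<le> T1" by (auto simp: T1_def)
  \<comment> \<open>The competitor \<open>t = S\<close> beats every \<open>t < T1\<close> because \<open>S * k (x / S)\<close> is of order \<open>S powr (1 - \<alpha>) * k x\<close>,
    while \<open>k (x / T1)\<close> is of order \<open>T1 powr (- \<alpha>) * k x\<close>.\<close>
  define S where "S = (4 * T1 powr \<alpha>) powr (1 / (\<alpha> - 1))"
  have S0: "0 < S" using T1 by (simp add: S_def)
  have "S powr (\<alpha> - 1) = 4 * T1 powr \<alpha>" using \<alpha> T1 by (simp add: S_def powr_powr)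
  then have "S powr \<alpha> = 4 * S * T1 powr \<alpha>" using powr_mult_base[of S "\<alpha> - 1"] S0 by simp
  then have "(S / T1) powr \<alpha> = 4 * S" using S0 T1 by (simp add: powr_divide)
  then have "\<forall>\<^sub>F u in at_top. 3 * S * k u \<le> k (S / T1 * u)"
    using S0 T1 by (intro regularly_varying_eventually_ge[OF rv_k]) auto
  moreover have S1: "1 \<le> S" unfolding S_def using \<alpha> T1
    by (intro ge_one_powr_ge_zero) (auto intro!: mult_ge1_I ge_one_powr_ge_zero)
  moreover have "\<forall>\<^sub>F u in at_top. m S \<le> k u \<and> 0 < k u"
    by (intro eventually_conj eventually_k_ge regularly_varying_eventually_pos[OF rv_k])
  ultimately have "\<forall>\<^sub>F u in at_top. 3 * S * k u \<le> k (S / T1 * u) \<and> m S \<le> k u \<and> 0 < k u"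
    by (simp add: eventually_conj_iff)
  from eventually_at_top_scale[OF _ this, of "1 / S"] S1
  have A: "\<forall>\<^sub>F x in at_top. 3 * S * k (x / S) \<le> k (x / T1) \<and> m S \<le> k (x / S) \<and> 0 < k (x / S)"
    by simp
  have "\<forall>\<^sub>F v in at_top. k (3 * T1) \<le> m v \<and> 0 < m v \<and> 1 \<le> v"
    by (intro eventually_conj eventually_m_ge regularly_varying_eventually_pos[OF rv_m] eventually_ge_at_top)
  from eventually_at_top_scale[OF _ this, of "1 / (3 * T1)"] T1
  have B: "\<forall>\<^sub>F x in at_top. k (3 * T1) \<le> m (x / (3 * T1)) \<and> 0 < m (x / (3 * T1)) \<and> 1 \<le> x / (3 * T1)"
    by simp
  show ?thesis
    using A B eventually_gt_at_top[of 0]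
  proof eventually_elim
    case (elim x)
    show ?case
    proof (intro allI impI)
      fix t :: real assume t: "1 \<le> t" and c: "cost x t \<le> 2 * h x"
      have "T1 \<le> t"
      proof (rule ccontr)
        assume "\<not> T1 \<le> t"
        then have "k (x / T1) \<le> k (x / t)"
          using t elim by (intro monoD[OF mono_k] divide_left_mono) auto
        then have "k (x / T1) \<le> 1 * max (m t) (k (x / t))" by simp
        also have "\<dots> \<le> cost x t"
          unfolding cost_def using t m_nonneg[of t] by (intro mult_right_mono) (auto simp: le_max_iff_disj)
        finally have "k (x / T1) \<le> cost x t" .
        moreover have "h x \<le> S * k (x / S)"
          using h_le_cost[OF S1, of x] elim(1) by (simp add: cost_def)
        moreover have "0 < S * k (x / S)" using S1 elim by simp
        ultimately show False using c elim(1) by linarith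
      qed
      moreover have "T1 \<le> x / t"
      proof (rule ccontr)
        assume "\<not> T1 \<le> x / t"
        then have xt: "x / T1 \<le> t" using t T1 by (simp add: field_simps)
        \<comment> \<open>At \<open>t = v\<close> the cost is \<open>v * m v\<close>, and every \<open>t\<close> beyond \<open>x / T1 = 3 * v\<close> costs at least three times as much.\<close>
        define v where "v = x / (3 * T1)"
        have v: "1 \<le> v" "k (3 * T1) \<le> m v" "0 < m v" using elim by (auto simp: v_def)
        have v3: "3 * v = x / T1" using T1 by (simp add: v_def)
        have "x / v = 3 * T1" using T1 elim by (simp add: v_def)
        then have "h x \<le> v * m v" using h_le_cost[OF v(1), of x] v by (simp add: cost_def)
        moreover have "3 * v * m v \<le> t * m t"
          using v xt v3 T1 t m_nonneg by (intro mult_mono monoD[OF mono_m]) auto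
        moreover have "t * m t \<le> cost x t" unfolding cost_def using t by (intro mult_left_mono) auto
        moreover have "0 < v * m v" using v by simp
        ultimately show False using c by linarith
      qed
      ultimately show "T \<le> t \<and> T \<le> x / t" using T1 by linarith
    qed
  qed
qed

text \<open>
  Multiplying \<open>x\<close> by \<open>l\<close> and \<open>t\<close> by \<open>s = l powr (\<alpha> / (\<alpha> + \<rho>))\<close> multiplies \<open>m t\<close> and \<open>k (x / t)\<close>
  by asymptotically the same factor \<open>s powr \<rho> = (l / s) powr \<alpha>\<close>, hence the cost by \<open>l powr \<gamma>\<close>.
\<close>
lemma rv_h: "regularly_varying \<gamma> h"
proof (rule regularly_varying_monoI[OF h_mono eventually_h_pos])
  fix l \<epsilon> :: real assume l: "0 < l" and \<epsilon>: "0 < \<epsilon>"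
  define s where "s = l powr (\<alpha> / (\<alpha> + \<rho>))"
  define p where "p = l powr (\<alpha> * \<rho> / (\<alpha> + \<rho>))"
  have pos: "0 < s" "0 < p" using l by (auto simp: s_def p_def)
  have ar: "0 < \<alpha> + \<rho>" using \<alpha> \<rho> by simp
  have sp: "s * p = l powr \<gamma>"
    unfolding s_def p_def \<gamma> powr_add[symmetric]
    by (simp add: add_divide_distrib[symmetric] algebra_simps)
  have p1: "s powr \<rho> = p" by (simp add: s_def p_def powr_powr)
  have "l / s = l powr 1 / l powr (\<alpha> / (\<alpha> + \<rho>))" using l by (simp add: s_def)
  also have "\<dots> = l powr (1 - \<alpha> / (\<alpha> + \<rho>))" by (simp only: powr_diff)
  also have "1 - \<alpha> / (\<alpha> + \<rho>) = \<rho> / (\<alpha> + \<rho>)" using ar by (simp add: field_simps)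
  finally have p2: "(l / s) powr \<alpha> = p" by (simp add: p_def powr_powr mult.commute)
  define \<eta> where "\<eta> = min 1 (\<epsilon> / 3)"
  have \<eta>: "0 < \<eta>" "\<eta> \<le> 1" using \<epsilon> by (auto simp: \<eta>_def)
  have "\<eta> * \<eta> \<le> \<eta> * 1" using \<eta> by (intro mult_left_mono) auto
  moreover have "3 * \<eta> \<le> \<epsilon>" by (simp add: \<eta>_def)
  ultimately have \<eta>2: "(1 + \<eta>) * (1 + \<eta>) \<le> 1 + \<epsilon>" by (simp add: algebra_simps)
  have "\<forall>\<^sub>F t in at_top. m (s * t) \<le> ((1 + \<eta>) * p) * m t \<and> k (l / s * t) \<le> ((1 + \<eta>) * p) * k t"
    using l pos \<eta> p1 p2
    by (intro eventually_conj regularly_varying_eventually_le[OF rv_m] regularly_varying_eventually_le[OF rv_k]) auto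
  then obtain N where N: "\<And>t. N \<le> t \<Longrightarrow> m (s * t) \<le> ((1 + \<eta>) * p) * m t"
      "\<And>t. N \<le> t \<Longrightarrow> k (l / s * t) \<le> ((1 + \<eta>) * p) * k t"
    by (auto simp: eventually_at_top_linorder)
  show "\<forall>\<^sub>F x in at_top. h (l * x) \<le> (1 + \<epsilon>) * l powr \<gamma> * h x"
    using near_minimisers_large[of "max N (1 / s)"] eventually_h_pos
  proof eventually_elim
    case (elim x)
    obtain t where t: "1 \<le> t" "cost x t < (1 + \<eta>) * h x"
      using near_minimiser_exists[OF elim(2) \<eta>(1)] by blast
    have "(1 + \<eta>) * h x \<le> 2 * h x" using \<eta> elim by (intro mult_right_mono) auto
    then have "cost x t \<le> 2 * h x" using t(2) by linarith
    then have "max N (1 / s) \<le> t \<and> max N (1 / s) \<le> x / t" using elim(1) t(1) by blast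
    then have tN: "N \<le> t" "1 / s \<le> t" "N \<le> x / t" by auto
    have st: "1 \<le> s * t" using tN(2) pos by (simp add: field_simps)
    have eq: "l * x / (s * t) = l / s * (x / t)" by simp
    have "h (l * x) \<le> s * t * max (m (s * t)) (k (l / s * (x / t)))"
      using h_le_cost[OF st, of "l * x"] unfolding cost_def eq .
    also have "\<dots> \<le> s * t * (((1 + \<eta>) * p) * max (m t) (k (x / t)))"
    proof (intro mult_left_mono)
      have "((1 + \<eta>) * p) * m t \<le> ((1 + \<eta>) * p) * max (m t) (k (x / t))"
           "((1 + \<eta>) * p) * k (x / t) \<le> ((1 + \<eta>) * p) * max (m t) (k (x / t))"
        using \<eta> pos by (intro mult_left_mono; simp)+
      then show "max (m (s * t)) (k (l / s * (x / t))) \<le> ((1 + \<eta>) * p) * max (m t) (k (x / t))"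
        using N(1)[OF tN(1)] N(2)[OF tN(3)] by linarith
    qed (use pos t in auto)
    also have "\<dots> = (1 + \<eta>) * (s * p) * cost x t" by (simp add: cost_def)
    also have "\<dots> \<le> (1 + \<eta>) * l powr \<gamma> * ((1 + \<eta>) * h x)"
      unfolding sp using t \<eta> l by (intro mult_left_mono) auto
    also have "\<dots> = ((1 + \<eta>) * (1 + \<eta>)) * (l powr \<gamma> * h x)" by (simp add: ac_simps)
    also have "\<dots> \<le> (1 + \<epsilon>) * (l powr \<gamma> * h x)" using \<eta>2 elim by (intro mult_right_mono) auto
    finally show ?case by (simp add: ac_simps)
  qed
qed

text \<open>
  A single large value of \<open>Q\<close> is far too expensive to matter: with \<open>t = T\<close> fixed, \<open>h x\<close> is at most
  of order \<open>T powr (1 - \<alpha>) * k x\<close>, and \<open>T\<close> is arbitrary.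
\<close>
lemma eventually_h_le_k:
  assumes \<eta>: "0 < \<eta>" and C: "0 \<le> C"
  shows "\<forall>\<^sub>F x in at_top. C * h x \<le> k (\<eta> * x)"
proof -
  define B where "B = 1 + C / \<eta> powr \<alpha>"
  have B: "1 \<le> B" "C < B * \<eta> powr \<alpha>" using C \<eta> by (auto simp: B_def field_simps)
  define T where "T = B powr (1 / (\<alpha> - 1))"
  have T1: "1 \<le> T" unfolding T_def using B \<alpha> by (intro ge_one_powr_ge_zero) auto
  have "T powr (\<alpha> - 1) = B" using \<alpha> B by (simp add: T_def powr_powr)
  then have "T powr \<alpha> = T * B" using powr_mult_base[of T "\<alpha> - 1"] T1 by simp
  then have "(\<eta> * T) powr \<alpha> = T * (B * \<eta> powr \<alpha>)" using T1 \<eta> by (simp add: powr_mult)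
  then have "C * T < (\<eta> * T) powr \<alpha>" using B T1 by (simp add: mult.commute[of C])
  then have "\<forall>\<^sub>F u in at_top. (C * T) * k u \<le> k ((\<eta> * T) * u)"
    using \<eta> T1 by (intro regularly_varying_eventually_ge[OF rv_k]) auto
  moreover have "\<forall>\<^sub>F u in at_top. m T \<le> k u"
    by (rule eventually_k_ge)
  ultimately have "\<forall>\<^sub>F u in at_top. (C * T) * k u \<le> k ((\<eta> * T) * u) \<and> m T \<le> k u"
    by (rule eventually_conj)
  from eventually_at_top_scale[OF _ this, of "1 / T"] T1
  have "\<forall>\<^sub>F x in at_top. (C * T) * k (x / T) \<le> k (\<eta> * x) \<and> m T \<le> k (x / T)" by simp
  then show ?thesis
  proof eventually_elim
    case (elim x)
    have "h x \<le> T * k (x / T)" using h_le_cost[OF T1, of x] elim by (simp add: cost_def)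
    then have "C * h x \<le> C * (T * k (x / T))" using C by (rule mult_left_mono)
    then show ?case using elim by (simp add: mult.assoc)
  qed
qed

definition \<zeta> :: real where "\<zeta> = \<gamma> / (\<gamma> - 1)"

definition c :: real where "c = \<zeta> powr (\<gamma> - 1)"

lemma \<zeta>_gt_1: "1 < \<zeta>"
  using \<gamma>_gt_1 by (simp add: \<zeta>_def)

lemma c_pos: "0 < c"
  using \<zeta>_gt_1 by (simp add: c_def)

text \<open>
  This is the optimisation behind the constant \<open>c\<close>: the convex function \<open>w powr \<gamma>\<close> lies above its
  tangent at \<open>\<zeta> * u\<close>, and that tangent vanishes exactly at \<open>w = u\<close>. So \<open>c * \<gamma> * u powr (\<gamma> - 1)\<close>, the
  derivative of \<open>c * u powr \<gamma>\<close>, is the minimal cost per unit length at level \<open>u\<close>.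
\<close>
lemma drift_bound:
  assumes "0 \<le> w" "0 < u"
  shows "c * \<gamma> * u powr (\<gamma> - 1) * (w - u) \<le> w powr \<gamma>"
proof -
  define v where "v = \<zeta> * u"
  have v: "0 < v" using \<zeta>_gt_1 assms by (simp add: v_def)
  have vu: "(\<gamma> - 1) * v = \<gamma> * u" using \<gamma>_gt_1 by (simp add: v_def \<zeta>_def)
  have "c * u powr (\<gamma> - 1) = v powr (\<gamma> - 1)"
    using \<zeta>_gt_1 assms by (simp add: v_def c_def powr_mult)
  then have "c * \<gamma> * u powr (\<gamma> - 1) * (w - u) = v powr (\<gamma> - 1) * (\<gamma> * w - \<gamma> * u)"
    by (simp add: algebra_simps)
  also have "\<dots> = v * v powr (\<gamma> - 1) + \<gamma> * v powr (\<gamma> - 1) * (w - v)"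
    unfolding vu[symmetric] by (simp add: algebra_simps)
  also have "v * v powr (\<gamma> - 1) = v powr \<gamma>" using v by (simp add: powr_mult_base)
  also have "v powr \<gamma> + \<gamma> * v powr (\<gamma> - 1) * (w - v) \<le> w powr \<gamma>"
    using assms v \<gamma>_gt_1 by (intro powr_ge_tangent) auto
  finally show ?thesis .
qed

section \<open>A potential that decreases along the recursion\<close>

text \<open>
  On the scale \<open>X\<close> the function \<open>(1 - 3 * \<epsilon>) * c * h\<close> is replaced by the pure power that it is close
  to, because the argument uses a convex and differentiable function. Truncation at \<open>2 * X\<close> keeps the potential bounded,
  so that its exponential is integrable and a large jump cannot gain more than a multiple of \<open>h X\<close>.
\<close>
definition potential :: "real \<Rightarrow> real \<Rightarrow> real \<Rightarrow> real" where
  "potential \<epsilon> X y = (1 - 3 * \<epsilon>) * c * h X * (max 0 (min y (2 * X)) / X) powr \<gamma>"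

text \<open>
  If \<open>t\<close> is large, then the step is small and the derivative of the potential at \<open>y\<close> decides: by
  \<open>drift_bound\<close> the gain is at most \<open>(1 - 2 * \<epsilon>) * h (q * t) / t\<close>, which is at most \<open>1 - 2 * \<epsilon>\<close> times
  the cost, and what is left of the cost pays for \<open>B\<close> because \<open>m t\<close> is large.
  If \<open>t\<close> is bounded, then either \<open>q\<close> is small and the potential drops by a multiple of \<open>h X\<close>, or \<open>q\<close>
  is comparable to \<open>X\<close> and \<open>k q\<close> exceeds any multiple of \<open>h X\<close>.
\<close>
lemma potential_increment:
  assumes \<epsilon>: "0 < \<epsilon>" "\<epsilon> < 1 / 3" and \<delta>: "0 < \<delta>" and B: "0 \<le> B"
  shows "\<forall>\<^sub>F X in at_top. \<forall>y\<in>{\<delta> * X..2 * X}. \<forall>q\<ge>0. \<forall>t\<ge>1.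
    potential \<epsilon> X ((1 - 1 / t) * y + q) - potential \<epsilon> X y \<le> (1 - \<epsilon>) * max (m t) (k q) - B"
proof -
  have \<gamma>1: "1 < \<gamma>" by (rule \<gamma>_gt_1)
  define H where "H = (1 - 3 * \<epsilon>) * c"
  have H: "0 < H" "H \<le> c" using \<epsilon> c_pos by (auto simp: H_def algebra_simps)
  \<comment> \<open>The passage from \<open>1 - 3 * \<epsilon>\<close> to \<open>1 - 2 * \<epsilon>\<close> leaves a factor \<open>1 - \<epsilon> = \<kappa> * \<kappa>\<close>: one \<open>\<kappa>\<close> for replacing
    \<open>h (w * X)\<close> by a power, the other for evaluating the derivative at \<open>u'\<close> instead of \<open>u\<close>.\<close>
  define \<kappa> where "\<kappa> = sqrt (1 - \<epsilon>)"
  define \<nu> where "\<nu> = 1 / \<kappa>"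
  have \<kappa>: "0 < \<kappa>" "\<kappa> < 1" "\<kappa> * \<kappa> = 1 - \<epsilon>" using \<epsilon> by (auto simp: \<kappa>_def)
  have \<nu>: "1 < \<nu>" "\<nu> * \<kappa> = 1" using \<kappa> by (auto simp: \<nu>_def)
  have "(1 - 3 * \<epsilon>) \<le> (1 - 2 * \<epsilon>) * (1 - \<epsilon>)" by (simp add: algebra_simps)
  then have "(1 - 3 * \<epsilon>) * (\<nu> * \<nu>) \<le> (1 - 2 * \<epsilon>) * (\<kappa> * \<kappa>) * (\<nu> * \<nu>)"
    unfolding \<kappa>(3) using \<nu> by (intro mult_right_mono) auto
  also have "\<dots> = (1 - 2 * \<epsilon>) * (\<nu> * \<kappa>) * (\<nu> * \<kappa>)" by (simp only: ac_simps)
  finally have \<nu>2: "(1 - 3 * \<epsilon>) * (\<nu> * \<nu>) \<le> 1 - 2 * \<epsilon>" by (simp add: \<nu>(2))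
  obtain K where K: "1 \<le> K" and far: "\<forall>\<^sub>F X in at_top. \<forall>w\<ge>K. (c * \<gamma> * 2 powr (\<gamma> - 1)) * w * h X \<le> h (w * X)"
    using regularly_varying_superlinear[OF h_mono rv_h \<gamma>1] by blast
  have near: "\<forall>\<^sub>F X in at_top. \<forall>w\<in>{\<delta>..K}. \<kappa> * w powr \<gamma> * h X \<le> h (w * X)"
    using \<gamma>1 \<kappa> \<delta> by (intro regularly_varying_uniform_ge[OF h_mono rv_h]) auto
  have "((\<lambda>T. (1 + K / \<delta> * inverse T) powr (\<gamma> - 1)) \<longlongrightarrow> (1 + K / \<delta> * 0) powr (\<gamma> - 1)) at_top"
    by (intro tendsto_intros tendsto_inverse_0_at_top filterlim_ident) auto
  then have "\<forall>\<^sub>F T in at_top. (1 + K / \<delta> * inverse T) powr (\<gamma> - 1) < \<nu>"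
    using \<nu> by (intro order_tendstoD(2)) auto
  then have "\<forall>\<^sub>F T in at_top. (1 + K / \<delta> * inverse T) powr (\<gamma> - 1) < \<nu> \<and> 1 \<le> T \<and> B / \<epsilon> \<le> m T \<and> B / (1 - \<epsilon>) \<le> m T"
    by (intro eventually_conj eventually_ge_at_top eventually_m_ge)
  then obtain T where T: "(1 + K / \<delta> * inverse T) powr (\<gamma> - 1) < \<nu>" "1 \<le> T" "B / \<epsilon> \<le> m T" "B / (1 - \<epsilon>) \<le> m T"
    by (auto simp: eventually_at_top_linorder)
  define \<theta> where "\<theta> = 1 - 1 / (2 * T)"
  have \<theta>: "0 \<le> \<theta>" "\<theta> < 1" using T by (auto simp: \<theta>_def)
  have \<theta>\<gamma>: "\<theta> powr \<gamma> < 1" using powr_less_mono2[of \<gamma> \<theta> 1] \<theta> \<gamma>1 by simp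
  define d where "d = \<delta> powr \<gamma> * (1 - \<theta> powr \<gamma>)"
  have d: "0 < d" using \<delta> \<theta>\<gamma> by (simp add: d_def)
  define C where "C = (c * 2 powr \<gamma> + B) / (1 - \<epsilon>)"
  have C: "0 \<le> C" using \<epsilon> B c_pos by (simp add: C_def)
  have "\<forall>\<^sub>F X in at_top. C * h X \<le> k (\<delta> / (2 * T) * X)"
    using \<delta> T C by (intro eventually_h_le_k) auto
  then show ?thesis
    using far near eventually_h_ge[of "max 1 (B / (H * d))"] eventually_gt_at_top[of 0]
  proof eventually_elim
    case (elim X)
    have X: "0 < X" by fact
    have hX: "1 \<le> h X" "B / (H * d) \<le> h X" using elim(4) by auto
    show ?case
    proof (intro ballI allI impI)
      fix y q t :: real assume y: "y \<in> {\<delta> * X..2 * X}" and q: "0 \<le> q" and t: "1 \<le> t"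
      define D where "D = max (m t) (k q)"
      define y' where "y' = (1 - 1 / t) * y + q"
      define u where "u = y / X"
      define u' where "u' = min (y' / X) 2"
      have "0 \<le> \<delta> * X" using \<delta> X by simp
      then have y0: "0 \<le> y" using y by (simp del: mult_nonneg_nonneg)
      have u12: "\<delta> \<le> u" "u \<le> 2" using y X by (auto simp: u_def field_simps)
      then have u: "\<delta> \<le> u" "u \<le> 2" "0 < u" using \<delta> by auto
      have y'0: "0 \<le> y'" unfolding y'_def using t y0 q by (intro add_nonneg_nonneg mult_nonneg_nonneg) auto
      have u': "0 \<le> u'" "u' \<le> 2" using y'0 X by (auto simp: u'_def)
      have clip: "max 0 (min z (2 * X)) / X = min (z / X) 2" if "0 \<le> z" for z
        using that X by (auto simp: min_def max_def pos_le_divide_eq pos_divide_le_eq)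
      have pot: "potential \<epsilon> X y' - potential \<epsilon> X y = H * h X * (u' powr \<gamma> - u powr \<gamma>)"
        unfolding potential_def clip[OF y0] clip[OF y'0] H_def u'_def[symmetric] u_def[symmetric] min_absorb1[OF u(2)]
        by (simp only: right_diff_distrib)
      have D0: "0 \<le> D" using m_nonneg[of t] by (simp add: D_def le_max_iff_disj)
      have HhX: "0 < H * h X" using H hX by simp
      have "H * h X * (u' powr \<gamma> - u powr \<gamma>) \<le> (1 - \<epsilon>) * D - B"
      proof (cases "T \<le> t")
        case True
        then have "m T \<le> D" unfolding D_def by (intro max.coboundedI1 monoD[OF mono_m])
        then have "B / \<epsilon> \<le> D" "B / (1 - \<epsilon>) \<le> D" using T by auto
        then have BD: "B \<le> \<epsilon> * D" "B \<le> (1 - \<epsilon>) * D" using \<epsilon> by (auto simp: field_simps)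
        show ?thesis
        proof (cases "y' \<le> y")
          case True
          then have "u' \<le> u" using X by (auto simp: u'_def u_def divide_right_mono min_le_iff_disj)
          then have "u' powr \<gamma> \<le> u powr \<gamma>" using u' \<gamma>1 by (intro powr_mono2) auto
          then have "H * h X * (u' powr \<gamma> - u powr \<gamma>) \<le> 0" using HhX by (intro mult_nonneg_nonpos) auto
          then show ?thesis using BD by linarith
        next
          case False
          define w where "w = q * t / X"
          have "y' - y = (w - u) * X / t" using t X by (simp add: y'_def w_def u_def field_simps)
          then have "y' = u * X + (w - u) * X / t" using X by (simp add: u_def)
          then have yw: "y' / X = u + (w - u) / t" using X by (simp add: add_divide_distrib)
          have "0 < (w - u) * X / t" using False \<open>y' - y = _\<close> by simp
          then have wu: "u < w" using t X by (simp add: zero_less_divide_iff zero_less_mult_iff)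
          have uu': "u \<le> u'" "u' - u \<le> (w - u) / t" "u' \<le> u + (w - u) / t"
            using yw wu t u by (auto simp: u'_def)
          have "u' powr \<gamma> - u powr \<gamma> \<le> \<gamma> * u' powr (\<gamma> - 1) * (u' - u)"
            using powr_ge_tangent[of u u' \<gamma>] u uu' \<gamma>1 by (simp add: algebra_simps)
          also have "\<dots> \<le> \<gamma> * u' powr (\<gamma> - 1) * ((w - u) / t)"
            using uu' \<gamma>1 by (intro mult_left_mono) auto
          finally have inc: "H * h X * (u' powr \<gamma> - u powr \<gamma>) \<le> H * h X * (\<gamma> * u' powr (\<gamma> - 1) * ((w - u) / t))"
            using HhX by (intro mult_left_mono) auto
          \<comment> \<open>For \<open>w \<le> K\<close> the endpoint \<open>u'\<close> is close to \<open>u\<close>; for larger \<open>w\<close> only \<open>u' \<le> 2\<close> is known, and the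
            superlinear growth of \<open>h\<close> compensates.\<close>
          have "H * \<gamma> * u' powr (\<gamma> - 1) * (w - u) * h X \<le> (1 - 2 * \<epsilon>) * h (w * X)"
          proof (cases "w \<le> K")
            case True
            have "(w - u) / t \<le> K / T"
              using True wu u \<open>T \<le> t\<close> T by (intro frac_le) auto
            also have "\<dots> = K / \<delta> * inverse T * \<delta>" using \<delta> by (simp add: field_simps)
            also have "\<dots> \<le> K / \<delta> * inverse T * u" using u K T \<delta> by (intro mult_left_mono) auto
            finally have "u' \<le> u + K / \<delta> * inverse T * u" using uu'(3) by linarith
            then have "u' \<le> (1 + K / \<delta> * inverse T) * u" by (simp only: distrib_right mult_1)
            then have "u' powr (\<gamma> - 1) \<le> ((1 + K / \<delta> * inverse T) * u) powr (\<gamma> - 1)"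
              using u' \<gamma>1 by (intro powr_mono2) auto
            also have "\<dots> = (1 + K / \<delta> * inverse T) powr (\<gamma> - 1) * u powr (\<gamma> - 1)"
              using u K T \<delta> by (intro powr_mult)
            also have "\<dots> \<le> \<nu> * u powr (\<gamma> - 1)" using T by (intro mult_right_mono) auto
            finally have "u' powr (\<gamma> - 1) \<le> \<nu> * u powr (\<gamma> - 1)" .
            then have "H * \<gamma> * u' powr (\<gamma> - 1) * (w - u) * h X \<le> H * \<gamma> * (\<nu> * u powr (\<gamma> - 1)) * (w - u) * h X"
              using H \<gamma>1 wu hX by (intro mult_right_mono mult_left_mono) auto
            also have "\<dots> = (1 - 3 * \<epsilon>) * \<nu> * (c * \<gamma> * u powr (\<gamma> - 1) * (w - u)) * h X"
              by (simp add: H_def)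
            also have "\<dots> \<le> (1 - 3 * \<epsilon>) * \<nu> * w powr \<gamma> * h X"
              using drift_bound[of w u] wu u hX \<nu> \<epsilon> by (intro mult_right_mono mult_left_mono) auto
            also have "\<dots> = (1 - 3 * \<epsilon>) * \<nu> * w powr \<gamma> * h X * (\<nu> * \<kappa>)" by (simp add: \<nu>(2))
            also have "\<dots> = ((1 - 3 * \<epsilon>) * (\<nu> * \<nu>)) * (\<kappa> * w powr \<gamma> * h X)" by (simp only: ac_simps)
            also have "\<dots> \<le> ((1 - 3 * \<epsilon>) * (\<nu> * \<nu>)) * h (w * X)"
            proof (rule mult_left_mono)
              show "\<kappa> * w powr \<gamma> * h X \<le> h (w * X)" using True wu u by (intro bspec[OF elim(3)]) simp
            qed (use \<epsilon> in simp)
            also have "\<dots> \<le> (1 - 2 * \<epsilon>) * h (w * X)"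
              using \<nu>2 h_nonneg by (intro mult_right_mono)
            finally show ?thesis .
          next
            case False
            have "u' powr (\<gamma> - 1) \<le> 2 powr (\<gamma> - 1)" using u' \<gamma>1 by (intro powr_mono2) auto
            then have "H * \<gamma> * u' powr (\<gamma> - 1) * (w - u) * h X \<le> H * \<gamma> * 2 powr (\<gamma> - 1) * w * h X"
              using H \<gamma>1 wu hX u by (intro mult_mono) auto
            also have "\<dots> = (1 - 3 * \<epsilon>) * ((c * \<gamma> * 2 powr (\<gamma> - 1)) * w * h X)" by (simp add: H_def)
            also have "\<dots> \<le> (1 - 3 * \<epsilon>) * h (w * X)"
            proof (rule mult_left_mono)
              show "(c * \<gamma> * 2 powr (\<gamma> - 1)) * w * h X \<le> h (w * X)" using False elim(2) by simp
            qed (use \<epsilon> in simp)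
            also have "\<dots> \<le> (1 - 2 * \<epsilon>) * h (w * X)"
              using \<epsilon> h_nonneg by (intro mult_right_mono) auto
            finally show ?thesis .
          qed
          moreover have "h (w * X) \<le> t * D"
            using h_le[OF t, of q] X unfolding w_def D_def by simp
          then have "(1 - 2 * \<epsilon>) * h (w * X) \<le> (1 - 2 * \<epsilon>) * (t * D)"
            using \<epsilon> by (intro mult_left_mono) auto
          moreover have "(1 - 2 * \<epsilon>) * (t * D) = (1 - 2 * \<epsilon>) * D * t" by simp
          ultimately have "H * \<gamma> * u' powr (\<gamma> - 1) * (w - u) * h X \<le> (1 - 2 * \<epsilon>) * D * t" by linarith
          then have "H * \<gamma> * u' powr (\<gamma> - 1) * (w - u) * h X / t \<le> (1 - 2 * \<epsilon>) * D"
            using t by (simp add: pos_divide_le_eq)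
          moreover have "H * h X * (\<gamma> * u' powr (\<gamma> - 1) * ((w - u) / t)) = H * \<gamma> * u' powr (\<gamma> - 1) * (w - u) * h X / t"
            by simp
          ultimately have "H * h X * (\<gamma> * u' powr (\<gamma> - 1) * ((w - u) / t)) \<le> (1 - 2 * \<epsilon>) * D" by linarith
          then have "H * h X * (u' powr \<gamma> - u powr \<gamma>) \<le> (1 - 2 * \<epsilon>) * D" using inc by linarith
          also have "\<dots> = (1 - \<epsilon>) * D - \<epsilon> * D" by (simp add: algebra_simps)
          finally show ?thesis using BD by linarith
        qed
      next
        case False
        then have "1 / T \<le> 1 / t" using t by (intro divide_left_mono) auto
        then have "(1 - 1 / t) * y \<le> (1 - 1 / T) * y" using y0 by (intro mult_right_mono) auto
        then have y': "y' \<le> (1 - 1 / T) * y + q" by (simp add: y'_def)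
        show ?thesis
        proof (cases "q \<le> y / (2 * T)")
          case True
          moreover have "\<theta> * y = (1 - 1 / T) * y + y / (2 * T)" using T by (simp add: \<theta>_def field_simps)
          ultimately have "y' \<le> \<theta> * y" using y' by linarith
          then have "y' / X \<le> \<theta> * u" using X by (simp add: u_def divide_right_mono)
          then have "u' \<le> \<theta> * u" by (simp add: u'_def min_le_iff_disj)
          then have "u' powr \<gamma> \<le> (\<theta> * u) powr \<gamma>" using u' \<gamma>1 by (intro powr_mono2) auto
          also have "\<dots> = \<theta> powr \<gamma> * u powr \<gamma>" using u \<theta> by (intro powr_mult)
          finally have "u powr \<gamma> * (1 - \<theta> powr \<gamma>) \<le> u powr \<gamma> - u' powr \<gamma>" by (simp add: algebra_simps)
          moreover have "d \<le> u powr \<gamma> * (1 - \<theta> powr \<gamma>)"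
            unfolding d_def using \<theta>\<gamma> u \<delta> \<gamma>1 by (intro mult_right_mono powr_mono2) auto
          ultimately have "d \<le> u powr \<gamma> - u' powr \<gamma>" by linarith
          then have "H * h X * d \<le> H * h X * (u powr \<gamma> - u' powr \<gamma>)"
            using HhX by (intro mult_left_mono) auto
          moreover have "B \<le> H * h X * d" using hX(2) H d by (simp add: pos_divide_le_eq ac_simps)
          moreover have "H * h X * (u' powr \<gamma> - u powr \<gamma>) = - (H * h X * (u powr \<gamma> - u' powr \<gamma>))"
            by (simp add: algebra_simps)
          moreover have "0 \<le> (1 - \<epsilon>) * D" using D0 \<epsilon> by simp
          ultimately show ?thesis by linarith
        next
          case False
          have "\<delta> / (2 * T) * X \<le> y / (2 * T)" using y T by (simp add: divide_right_mono)
          then have "k (\<delta> / (2 * T) * X) \<le> k q" using False by (intro monoD[OF mono_k]) linarith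
          also have "\<dots> \<le> D" by (simp add: D_def)
          finally have "C * h X \<le> D" using elim(1) by linarith
          then have "(1 - \<epsilon>) * (C * h X) \<le> (1 - \<epsilon>) * D" using \<epsilon> by (intro mult_left_mono) auto
          moreover have "(1 - \<epsilon>) * C = c * 2 powr \<gamma> + B" using \<epsilon> by (simp add: C_def)
          ultimately have CD: "(c * 2 powr \<gamma> + B) * h X \<le> (1 - \<epsilon>) * D" by (simp add: mult.assoc[symmetric])
          have "u' powr \<gamma> \<le> 2 powr \<gamma>" using u' \<gamma>1 by (intro powr_mono2) auto
          then have "u' powr \<gamma> - u powr \<gamma> \<le> 2 powr \<gamma>" using powr_ge_zero[of u \<gamma>] by linarith
          then have "H * h X * (u' powr \<gamma> - u powr \<gamma>) \<le> H * h X * 2 powr \<gamma>"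
            using HhX by (intro mult_left_mono) auto
          also have "\<dots> \<le> c * h X * 2 powr \<gamma>" using H hX by (intro mult_right_mono) auto
          finally have "H * h X * (u' powr \<gamma> - u powr \<gamma>) \<le> c * 2 powr \<gamma> * h X" by (simp add: ac_simps)
          moreover have "B * 1 \<le> B * h X" using B hX by (intro mult_left_mono)
          ultimately show ?thesis using CD by (simp add: algebra_simps)
        qed
      qed
      then show "potential \<epsilon> X ((1 - 1 / t) * y + q) - potential \<epsilon> X y \<le> (1 - \<epsilon>) * max (m t) (k q) - B"
        using pot by (simp add: y'_def D_def)
    qed
  qed
qed

section \<open>Climbing along a path of cheap steps\<close>

lemma iterate_step:
  assumes step: "\<And>y q t. 0 \<le> y \<Longrightarrow> 0 \<le> q \<Longrightarrow> 1 \<le> t \<Longrightarrow> V ((1 - 1 / t) * y + q) \<le> V y + max (m t) (k q)"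
    and y: "0 \<le> y" "y \<le> z" and t: "1 \<le> t"
  shows "V (z - (1 - 1 / t) ^ n * (z - y)) \<le> V y + n * max (m t) (k (z / t))"
proof (induction n)
  case (Suc n)
  define y' where "y' = z - (1 - 1 / t) ^ n * (z - y)"
  have "(1 - 1 / t) ^ n \<le> 1" using t by (intro power_le_one) auto
  then have "(1 - 1 / t) ^ n * (z - y) \<le> 1 * (z - y)" using y by (intro mult_right_mono) auto
  then have "0 \<le> y'" using y by (simp add: y'_def)
  then have "V ((1 - 1 / t) * y' + z / t) \<le> V y' + max (m t) (k (z / t))"
    using y t by (intro step) auto
  moreover have "(1 - 1 / t) * y' + z / t = z - (1 - 1 / t) ^ Suc n * (z - y)"
    using t by (simp add: y'_def field_simps)
  ultimately show ?case using Suc by (simp add: y'_def algebra_simps)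
qed simp

text \<open>
  Each step multiplies the distance to \<open>z\<close> by \<open>1 - 1 / t \<le> exp (- 1 / t)\<close>, so about
  \<open>t * ln ((z - y) / (z - x))\<close> steps lead from \<open>y\<close> to \<open>x\<close>; rounding up the number of steps accounts for
  the term \<open>1 / t\<close>.
\<close>
lemma climb:
  assumes mono: "mono V"
    and step: "\<And>y q t. 0 \<le> y \<Longrightarrow> 0 \<le> q \<Longrightarrow> 1 \<le> t \<Longrightarrow> V ((1 - 1 / t) * y + q) \<le> V y + max (m t) (k q)"
    and y: "0 \<le> y" "y \<le> x" "x < z" and t: "1 \<le> t"
  shows "V x \<le> V y + (ln ((z - y) / (z - x)) + 1 / t) * cost z t"
proof -
  define L where "L = ln ((z - y) / (z - x))"
  define n where "n = nat \<lceil>t * L\<rceil>"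
  have L: "0 \<le> L" unfolding L_def using y by (intro ln_ge_zero) auto
  have tL: "0 \<le> t * L" using L t by simp
  then have n: "t * L \<le> n" "real n \<le> t * L + 1" unfolding n_def by linarith+
  have e: "1 - 1 / t \<le> exp (- (1 / t))" using exp_ge_add_one_self[of "- (1 / t)"] by simp
  have "(1 - 1 / t) ^ n \<le> exp (- (1 / t)) ^ n" using e t by (intro power_mono) auto
  also have "\<dots> = exp (- (n / t))" by (simp add: exp_of_nat_mult[symmetric])
  also have "\<dots> \<le> exp (- L)" using n t by (simp add: field_simps)
  also have "\<dots> = (z - x) / (z - y)" unfolding L_def using y by (simp add: exp_minus field_simps)
  finally have "(1 - 1 / t) ^ n * (z - y) \<le> z - x" using y by (simp add: field_simps)
  then have "V x \<le> V (z - (1 - 1 / t) ^ n * (z - y))" by (intro monoD[OF mono]) simp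
  also have "\<dots> \<le> V y + n * max (m t) (k (z / t))"
    using y t by (intro iterate_step step) auto
  also have "n * max (m t) (k (z / t)) \<le> (t * L + 1) * max (m t) (k (z / t))"
    using n m_nonneg[of t] by (intro mult_right_mono) (auto simp: le_max_iff_disj)
  also have "(t * L + 1) * max (m t) (k (z / t)) = (L + 1 / t) * cost z t"
    using t by (simp add: cost_def field_simps)
  finally show ?thesis by (simp add: L_def)
qed

text \<open>
  The target \<open>z = \<zeta> * x\<close> is the optimal one at level \<open>x\<close>; it is kept fixed on the whole way from
  \<open>l * x\<close> to \<open>x\<close>, which costs little when \<open>l\<close> is close to \<open>1\<close>.
\<close>
lemma scale_recursion:
  assumes mono: "mono V"
    and step: "\<And>y q t. 0 \<le> y \<Longrightarrow> 0 \<le> q \<Longrightarrow> 1 \<le> t \<Longrightarrow> V ((1 - 1 / t) * y + q) \<le> V y + max (m t) (k q)"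
    and l: "0 < l" "l < 1" and a: "\<zeta> powr \<gamma> * ln ((\<zeta> - l) / (\<zeta> - 1)) < a"
  shows "\<forall>\<^sub>F x in at_top. V x \<le> V (l * x) + a * h x"
proof -
  define L where "L = ln ((\<zeta> - l) / (\<zeta> - 1))"
  have L: "0 \<le> L" unfolding L_def using l \<zeta>_gt_1 by (intro ln_ge_zero) auto
  have "((\<lambda>\<eta>. (L + \<eta>) * (1 + \<eta>) * ((1 + \<eta>) * \<zeta> powr \<gamma>)) \<longlongrightarrow> (L + 0) * (1 + 0) * ((1 + 0) * \<zeta> powr \<gamma>)) (at_right 0)"
    by (intro tendsto_intros)
  then have "\<forall>\<^sub>F \<eta> in at_right 0. (L + \<eta>) * (1 + \<eta>) * ((1 + \<eta>) * \<zeta> powr \<gamma>) < a"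
    using a by (intro order_tendstoD(2)) (auto simp: L_def mult.commute)
  moreover have "\<forall>\<^sub>F \<eta> in at_right (0::real). 0 < \<eta> \<and> \<eta> < 1"
    by (intro eventually_conj eventually_at_right_less eventually_at_rightI[of 0 1]) auto
  ultimately have "\<forall>\<^sub>F \<eta> in at_right 0. (L + \<eta>) * (1 + \<eta>) * ((1 + \<eta>) * \<zeta> powr \<gamma>) < a \<and> 0 < \<eta> \<and> \<eta> < 1"
    by (rule eventually_conj)
  then obtain \<eta> where \<eta>: "(L + \<eta>) * (1 + \<eta>) * ((1 + \<eta>) * \<zeta> powr \<gamma>) < a" "0 < \<eta>" "\<eta> < 1"
    using eventually_happens'[OF trivial_limit_at_right_real] by blast
  have "\<zeta> powr \<gamma> < (1 + \<eta>) * \<zeta> powr \<gamma>" using \<eta> \<zeta>_gt_1 by (simp add: algebra_simps)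
  then have "\<forall>\<^sub>F x in at_top. h (\<zeta> * x) \<le> ((1 + \<eta>) * \<zeta> powr \<gamma>) * h x"
    using \<zeta>_gt_1 by (intro regularly_varying_eventually_le[OF rv_h]) auto
  moreover have "\<forall>\<^sub>F x in at_top. (\<forall>t\<ge>1. cost (\<zeta> * x) t \<le> 2 * h (\<zeta> * x) \<longrightarrow> 1 / \<eta> \<le> t \<and> 1 / \<eta> \<le> \<zeta> * x / t) \<and> 0 < h (\<zeta> * x)"
    using \<zeta>_gt_1
    by (intro eventually_conj eventually_at_top_scale[OF _ near_minimisers_large] eventually_at_top_scale[OF _ eventually_h_pos]) auto
  ultimately show ?thesis using eventually_gt_at_top[of 0]
  proof eventually_elim
    case (elim x)
    obtain t where t: "1 \<le> t" "cost (\<zeta> * x) t < (1 + \<eta>) * h (\<zeta> * x)"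
      using near_minimiser_exists[of "\<zeta> * x" \<eta>] elim(2) \<eta> by blast
    have "(1 + \<eta>) * h (\<zeta> * x) \<le> 2 * h (\<zeta> * x)" using \<eta> elim by (intro mult_right_mono) auto
    then have "cost (\<zeta> * x) t \<le> 2 * h (\<zeta> * x)" using t(2) by linarith
    then have "1 / \<eta> \<le> t" using elim(2) t(1) by blast
    then have t\<eta>: "1 / t \<le> \<eta>" using t \<eta> by (simp add: field_simps)
    have x1: "l * x \<le> x" "x < \<zeta> * x" "0 \<le> l * x" using l \<zeta>_gt_1 elim(3) by auto
    have "(\<zeta> * x - l * x) / (\<zeta> * x - x) = ((\<zeta> - l) * x) / ((\<zeta> - 1) * x)"
      by (simp add: algebra_simps)
    also have "\<dots> = (\<zeta> - l) / (\<zeta> - 1)" using elim(3) by simp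
    finally have eq: "(\<zeta> * x - l * x) / (\<zeta> * x - x) = (\<zeta> - l) / (\<zeta> - 1)" .
    have "V x \<le> V (l * x) + (L + 1 / t) * cost (\<zeta> * x) t"
      using climb[OF mono step x1(3,1,2) t(1)] by (simp add: eq L_def)
    also have "(L + 1 / t) * cost (\<zeta> * x) t \<le> (L + \<eta>) * ((1 + \<eta>) * (((1 + \<eta>) * \<zeta> powr \<gamma>) * h x))"
    proof (rule mult_mono)
      have "(1 + \<eta>) * h (\<zeta> * x) \<le> (1 + \<eta>) * (((1 + \<eta>) * \<zeta> powr \<gamma>) * h x)"
        using elim(1) \<eta> by (intro mult_left_mono) auto
      then show "cost (\<zeta> * x) t \<le> (1 + \<eta>) * (((1 + \<eta>) * \<zeta> powr \<gamma>) * h x)" using t(2) by linarith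
    qed (use t\<eta> L \<eta> cost_nonneg[OF t(1)] in auto)
    also have "\<dots> = ((L + \<eta>) * (1 + \<eta>) * ((1 + \<eta>) * \<zeta> powr \<gamma>)) * h x" by (simp only: ac_simps)
    also have "\<dots> \<le> a * h x" using \<eta> h_nonneg by (intro mult_right_mono) auto
    finally show ?case by simp
  qed
qed

text \<open>
  The bound \<open>V x0 + b * h\<close> reproduces itself under the recursion because \<open>b * \<mu> + a = b\<close>.
\<close>
lemma geometric_recursion:
  assumes mono: "mono V" and l: "0 < l" "l < 1" and b: "0 \<le> b"
    and x0: "0 < x0" and rec: "\<And>x. x0 \<le> x \<Longrightarrow> V x \<le> V (l * x) + a * h x"
    and dec: "\<And>x. x0 \<le> x \<Longrightarrow> h (l * x) \<le> \<mu> * h x" and ab: "a = b * (1 - \<mu>)"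
  shows "V x \<le> V x0 + b * h x"
proof -
  have "l ^ n * x \<le> x0 \<Longrightarrow> V x \<le> V x0 + b * h x" for n x
  proof (induction n arbitrary: x)
    case 0
    then have "V x \<le> V x0" by (intro monoD[OF mono]) simp
    moreover have "0 \<le> b * h x" using b h_nonneg by simp
    ultimately show ?case by linarith
  next
    case (Suc n)
    show ?case
    proof (cases "x0 \<le> x")
      case True
      have "V (l * x) \<le> V x0 + b * h (l * x)"
        using Suc.prems by (intro Suc.IH) (simp add: ac_simps)
      also have "b * h (l * x) \<le> b * (\<mu> * h x)" using dec[OF True] b by (intro mult_left_mono) auto
      finally have "V x \<le> V x0 + b * (\<mu> * h x) + a * h x" using rec[OF True] by linarith
      also have "\<dots> = V x0 + b * h x" by (simp add: ab algebra_simps)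
      finally show ?thesis .
    next
      case False
      then have "V x \<le> V x0" by (intro monoD[OF mono]) simp
      moreover have "0 \<le> b * h x" using b h_nonneg by simp
      ultimately show ?thesis by linarith
    qed
  qed
  moreover have "\<exists>n. l ^ n * x \<le> x0"
  proof (cases "0 < x")
    case True
    obtain n where "l ^ n < x0 / x" using real_arch_pow_inv[of "x0 / x" l] True x0 l by auto
    then have "l ^ n * x \<le> x0" using True by (simp add: field_simps)
    then show ?thesis by blast
  next
    case False
    then have "l ^ 0 * x \<le> x0" using x0 by simp
    then show ?thesis by blast
  qed
  ultimately show ?thesis by blast
qed

text \<open>
  The recursion sums up to \<open>\<zeta> powr \<gamma> * ln ((\<zeta> - l) / (\<zeta> - 1)) / (1 - l powr \<gamma>)\<close> times \<open>h x\<close>, and this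
  factor tends to \<open>\<zeta> powr \<gamma> / (\<gamma> * (\<zeta> - 1)) = c\<close> as \<open>l\<close> tends to \<open>1\<close> from below.
\<close>
lemma climbing_cost:
  assumes mono: "mono V"
    and step: "\<And>y q t. 0 \<le> y \<Longrightarrow> 0 \<le> q \<Longrightarrow> 1 \<le> t \<Longrightarrow> V ((1 - 1 / t) * y + q) \<le> V y + max (m t) (k q)"
    and b: "c < b"
  shows "\<forall>\<^sub>F x in at_top. V x \<le> b * h x"
proof -
  have \<gamma>1: "1 < \<gamma>" by (rule \<gamma>_gt_1)
  have b0: "0 < b" using c_pos b by simp
  have "((\<lambda>l. b * l powr (\<gamma> - 1)) \<longlongrightarrow> b * 1 powr (\<gamma> - 1)) (at_left (1::real))"
    by (intro tendsto_intros) auto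
  then have "\<forall>\<^sub>F l in at_left 1. c < b * l powr (\<gamma> - 1)"
    using b by (intro order_tendstoD(1)) auto
  moreover have "\<forall>\<^sub>F l in at_left (1::real). l \<in> {0<..<1}"
    by (rule eventually_at_leftI[of 0]) auto
  ultimately have "\<forall>\<^sub>F l in at_left 1. c < b * l powr (\<gamma> - 1) \<and> l \<in> {0<..<1}"
    by (rule eventually_conj)
  then obtain l where l: "c < b * l powr (\<gamma> - 1)" "0 < l" "l < 1"
    using eventually_happens'[OF trivial_limit_at_left_real] by fastforce
  define L where "L = ln ((\<zeta> - l) / (\<zeta> - 1))"
  have "(\<zeta> - l) / (\<zeta> - 1) = 1 + (1 - l) / (\<zeta> - 1)" using \<zeta>_gt_1 by (simp add: field_simps)
  then have "L \<le> (1 - l) / (\<zeta> - 1)"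
    unfolding L_def using l \<zeta>_gt_1 by (simp only:) (intro ln_add_one_self_le_self, auto)
  then have "\<zeta> powr \<gamma> * L \<le> \<zeta> powr \<gamma> * ((1 - l) / (\<zeta> - 1))" by (intro mult_left_mono) auto
  also have "\<dots> = c * \<gamma> * (1 - l)"
  proof -
    have "\<zeta> powr \<gamma> = \<zeta> * c" using powr_mult_base[of \<zeta> "\<gamma> - 1"] \<zeta>_gt_1 by (simp add: c_def)
    moreover have "\<zeta> - 1 = 1 / (\<gamma> - 1)" using \<gamma>1 by (simp add: \<zeta>_def field_simps)
    ultimately show ?thesis using \<gamma>1 by (simp add: \<zeta>_def)
  qed
  also have "\<dots> < (b * l powr (\<gamma> - 1)) * \<gamma> * (1 - l)"
    using l \<gamma>1 by (intro mult_strict_right_mono) auto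
  also have "\<dots> = b * (\<gamma> * l powr (\<gamma> - 1) * (1 - l))" by simp
  also have "\<dots> \<le> b * (1 - l powr \<gamma>)"
    using powr_ge_tangent[of 1 l \<gamma>] l \<gamma>1 b0 by (intro mult_left_mono) auto
  finally have gap: "\<zeta> powr \<gamma> * L < b * (1 - l powr \<gamma>)" .
  \<comment> \<open>The gap is shared between the two errors of the asymptotic recursion, in \<open>a\<close> and in \<open>\<mu>\<close>, and the
    constant \<open>V x0\<close> that remains at the end.\<close>
  define g where "g = b * (1 - l powr \<gamma>) - \<zeta> powr \<gamma> * L"
  define \<mu> where "\<mu> = l powr \<gamma> + g / (4 * b)"
  define a where "a = \<zeta> powr \<gamma> * L + g / 4"
  define b' where "b' = a / (1 - \<mu>)"
  have g: "0 < g" using gap by (simp add: g_def)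
  have L0: "0 \<le> L" unfolding L_def using l \<zeta>_gt_1 by (intro ln_ge_zero) auto
  have b\<mu>: "b * (1 - \<mu>) = a + g / 2" using b0 by (simp add: \<mu>_def a_def g_def field_simps)
  have a0: "0 \<le> a" using L0 g by (simp add: a_def)
  then have "0 < b * (1 - \<mu>)" using b\<mu> g by simp
  then have \<mu>1: "0 < 1 - \<mu>" using b0 by (simp add: zero_less_mult_iff)
  have b': "b' < b" "0 \<le> b'" "a = b' * (1 - \<mu>)"
    using \<mu>1 b\<mu> g a0 by (auto simp: b'_def pos_divide_less_eq)
  have "\<forall>\<^sub>F x in at_top. V x \<le> V (l * x) + a * h x"
    using l g by (intro scale_recursion mono step) (auto simp: a_def L_def)
  moreover have "\<forall>\<^sub>F x in at_top. h (l * x) \<le> \<mu> * h x"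
    using l g b0 by (intro regularly_varying_eventually_le[OF rv_h]) (auto simp: \<mu>_def)
  ultimately have "\<forall>\<^sub>F x in at_top. V x \<le> V (l * x) + a * h x \<and> h (l * x) \<le> \<mu> * h x"
    by (rule eventually_conj)
  then obtain x1 where x1: "\<And>x. x1 \<le> x \<Longrightarrow> V x \<le> V (l * x) + a * h x" "\<And>x. x1 \<le> x \<Longrightarrow> h (l * x) \<le> \<mu> * h x"
    by (auto simp: eventually_at_top_linorder)
  define x0 where "x0 = max x1 1"
  have V: "V x \<le> V x0 + b' * h x" for x
    by (rule geometric_recursion[OF mono l(2,3) b'(2) _ _ _ b'(3)]) (auto simp: x0_def intro: x1)
  show ?thesis
    using eventually_h_ge[of "V x0 / (b - b')"]
  proof eventually_elim
    case (elim x)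
    then have "V x0 \<le> (b - b') * h x" using b' by (simp add: field_simps)
    then show ?case using V[of x] by (simp add: algebra_simps)
  qed
qed

end

section \<open>Exponential moments of log-tails\<close>

context prob_space
begin

text \<open>
  An upper set of reals is a countable increasing union of closed half-lines whose endpoints
  belong to it.
\<close>
lemma prob_upper_set_le:
  fixes X :: "'a \<Rightarrow> real"
  assumes [measurable]: "X \<in> borel_measurable M"
    and up: "\<And>x y. x \<in> U \<Longrightarrow> x \<le> y \<Longrightarrow> y \<in> U"
    and le: "\<And>x. x \<in> U \<Longrightarrow> prob {\<omega>\<in>space M. x \<le> X \<omega>} \<le> C" and C: "0 \<le> C"
  shows "prob {\<omega>\<in>space M. X \<omega> \<in> U} \<le> C"
proof (cases "\<exists>s. decseq s \<and> (\<forall>n. s n \<in> U) \<and> (\<forall>x\<in>U. \<exists>n. s n \<le> x)")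
  case True
  then obtain s where s: "decseq s" "\<And>n. s n \<in> U" "\<And>x. x \<in> U \<Longrightarrow> \<exists>n. s n \<le> x" by blast
  define A where "A n = {\<omega>\<in>space M. s n \<le> X \<omega>}" for n
  have "incseq A"
    unfolding incseq_def A_def using s(1) by (auto simp: decseq_def intro: order_trans)
  moreover have "range A \<subseteq> events" by (auto simp: A_def)
  ultimately have "(\<lambda>n. prob (A n)) \<longlonglongrightarrow> prob (\<Union>n. A n)"
    by (intro finite_Lim_measure_incseq)
  moreover have "(\<Union>n. A n) = {\<omega>\<in>space M. X \<omega> \<in> U}"
    using s(3) up[OF s(2)] by (auto simp: A_def)
  moreover have "prob (A n) \<le> C" for n using le[OF s(2)] by (simp add: A_def)
  ultimately show ?thesis by (intro LIMSEQ_le_const2) auto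
next
  case False
  have "U = {}"
  proof (rule ccontr)
    assume ne: "U \<noteq> {}"
    have min: "\<exists>y\<in>U. y < x" if "x \<in> U" for x
    proof (rule ccontr)
      assume "\<not> (\<exists>y\<in>U. y < x)"
      then have "decseq (\<lambda>n::nat. x) \<and> (\<forall>n::nat. x \<in> U) \<and> (\<forall>y\<in>U. \<exists>n::nat. x \<le> y)"
        using that by (auto simp: decseq_def not_less)
      then show False using False by blast
    qed
    show False
    proof (cases "bdd_below U")
      case True
      define s where "s n = Inf U + 1 / real (Suc n)" for n
      have "decseq s" unfolding decseq_def s_def by (auto simp: frac_le)
      moreover have "s n \<in> U" for n
      proof -
        obtain y where "y \<in> U" "y < s n" using cInf_lessD[OF ne, of "s n"] by (auto simp: s_def)
        then show ?thesis using up[of y "s n"] by simp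
      qed
      moreover have "\<exists>n. s n \<le> x" if x: "x \<in> U" for x
      proof -
        obtain y where "y \<in> U" "y < x" using min[OF x] by blast
        then have "0 < x - Inf U" using cInf_lower[OF _ True, of y] by simp
        then obtain n where "1 / real (Suc n) < x - Inf U" using nat_approx_posE by blast
        then show ?thesis by (intro exI[of _ n]) (simp add: s_def)
      qed
      ultimately show False using False by blast
    next
      case unbounded: False
      define s where "s n = - real n" for n
      have "decseq s" by (auto simp: decseq_def s_def)
      moreover have "s n \<in> U" for n
      proof -
        obtain y where "y \<in> U" "y < s n" using unbounded by (auto simp: bdd_below_def not_le)
        then show ?thesis using up[of y "s n"] by simp
      qed
      moreover have "\<exists>n. s n \<le> x" for x
      proof -
        obtain n where "- x \<le> real n" using real_arch_simple by blast
        then show ?thesis by (intro exI[of _ n]) (simp add: s_def)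
      qed
      ultimately show False using False by blast
    qed
  qed
  then show ?thesis using C by simp
qed

text \<open>
  By \<open>prob_upper_set_le\<close> the variable \<open>g X\<close> exceeds \<open>n\<close> with probability at most \<open>C * exp (- n)\<close>,
  whether or not the law of \<open>X\<close> has atoms, and this is summable against \<open>exp (\<theta> * (n + 1))\<close>.
\<close>
lemma exp_moment_of_tail:
  fixes X :: "'a \<Rightarrow> real"
  assumes X[measurable]: "X \<in> borel_measurable M" and g: "mono g" "\<And>x. 0 \<le> g x"
    and tail: "\<And>x. prob {\<omega>\<in>space M. x \<le> X \<omega>} \<le> C * exp (- g x)" and C: "0 \<le> C"
    and \<theta>: "0 \<le> \<theta>" "\<theta> < 1"
  shows "integrable M (\<lambda>\<omega>. exp (\<theta> * g (X \<omega>)))"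
proof (rule integrableI_bounded)
  have [measurable]: "g \<in> borel_measurable borel" by (rule borel_measurable_mono[OF g(1)])
  show "(\<lambda>\<omega>. exp (\<theta> * g (X \<omega>))) \<in> borel_measurable M" by simp
  define A where "A n = {\<omega>\<in>space M. real n \<le> g (X \<omega>)}" for n
  have A[measurable]: "A n \<in> events" for n by (simp add: A_def)
  have PA: "prob (A n) \<le> C * exp (- real n)" for n
  proof -
    have "prob {\<omega>\<in>space M. X \<omega> \<in> {x. real n \<le> g x}} \<le> C * exp (- real n)"
    proof (rule prob_upper_set_le[OF X])
      show "y \<in> {x. real n \<le> g x}" if "x \<in> {x. real n \<le> g x}" "x \<le> y" for x y
        using that monoD[OF g(1), of x y] by simp
      show "prob {\<omega>\<in>space M. x \<le> X \<omega>} \<le> C * exp (- real n)" if "x \<in> {x. real n \<le> g x}" for x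
      proof -
        have "C * exp (- g x) \<le> C * exp (- real n)" using that C by (intro mult_left_mono) auto
        then show ?thesis using tail[of x] by linarith
      qed
    qed (use C in simp)
    then show ?thesis by (simp add: A_def)
  qed
  define f where "f \<omega> n = ennreal (exp (\<theta> * (real n + 1))) * indicator (A n) \<omega>" for \<omega> n
  have f: "f \<omega> n \<le> (\<Sum>n. f \<omega> n)" for \<omega> n
    using sum_le_suminf[OF summableI, of "{n}" "f \<omega>"] by simp
  have "(\<integral>\<^sup>+ \<omega>. ennreal (norm (exp (\<theta> * g (X \<omega>)))) \<partial>M)
      \<le> (\<integral>\<^sup>+ \<omega>. (\<Sum>n. ennreal (exp (\<theta> * (real n + 1))) * indicator (A n) \<omega>) \<partial>M)"
  proof (rule nn_integral_mono)
    fix \<omega> assume \<omega>: "\<omega> \<in> space M"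
    define n where "n = nat \<lfloor>g (X \<omega>)\<rfloor>"
    have n: "real n \<le> g (X \<omega>)" "g (X \<omega>) \<le> real n + 1"
      using g(2)[of "X \<omega>"] unfolding n_def by linarith+
    have "ennreal (norm (exp (\<theta> * g (X \<omega>)))) \<le> ennreal (exp (\<theta> * (real n + 1)))"
      using n \<theta> by (intro ennreal_leI) (auto intro: mult_left_mono)
    also have "\<dots> = ennreal (exp (\<theta> * (real n + 1))) * indicator (A n) \<omega>"
      using \<omega> n by (simp add: A_def)
    also have "\<dots> \<le> (\<Sum>n. ennreal (exp (\<theta> * (real n + 1))) * indicator (A n) \<omega>)"
      using f[of \<omega> n] by (simp only: f_def)
    finally show "ennreal (norm (exp (\<theta> * g (X \<omega>)))) \<le> (\<Sum>n. ennreal (exp (\<theta> * (real n + 1))) * indicator (A n) \<omega>)" .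
  qed
  also have "\<dots> = (\<Sum>n. ennreal (exp (\<theta> * (real n + 1))) * emeasure M (A n))"
    by (subst nn_integral_suminf) (auto simp: nn_integral_cmult_indicator)
  also have "\<dots> \<le> (\<Sum>n. ennreal (C * exp \<theta> * exp (\<theta> - 1) ^ n))"
  proof (intro suminf_le summableI)
    fix n
    have "ennreal (exp (\<theta> * (real n + 1))) * emeasure M (A n) = ennreal (exp (\<theta> * (real n + 1)) * prob (A n))"
      by (simp add: emeasure_eq_measure ennreal_mult')
    also have "\<dots> \<le> ennreal (exp (\<theta> * (real n + 1)) * (C * exp (- real n)))"
      using PA by (intro ennreal_leI mult_left_mono) auto
    also have "exp (\<theta> * (real n + 1)) * (C * exp (- real n)) = C * exp \<theta> * exp (\<theta> - 1) ^ n"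
      by (simp add: exp_of_nat_mult[symmetric] exp_add[symmetric] algebra_simps)
    finally show "ennreal (exp (\<theta> * (real n + 1))) * emeasure M (A n) \<le> ennreal (C * exp \<theta> * exp (\<theta> - 1) ^ n)" .
  qed
  also have "\<dots> = ennreal (\<Sum>n. C * exp \<theta> * exp (\<theta> - 1) ^ n)"
    using C \<theta> by (intro suminf_ennreal2 summable_mult summable_geometric) auto
  also have "\<dots> < \<infinity>" by simp
  finally show "(\<integral>\<^sup>+ \<omega>. ennreal (norm (exp (\<theta> * g (X \<omega>)))) \<partial>M) < \<infinity>" .
qed

end

definition log_tail :: "'a measure \<Rightarrow> ('a \<Rightarrow> real) \<Rightarrow> real \<Rightarrow> real" where
  "log_tail \<Omega> X x = - ln (\<P>(\<omega> in \<Omega>. X \<omega> > x))"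

context prob_space
begin

lemma log_tail_nonneg: "0 \<le> log_tail M X x"
proof (cases "prob {\<omega>\<in>space M. x < X \<omega>} = 0")
  case False
  then have "0 < prob {\<omega>\<in>space M. x < X \<omega>}" by (simp add: zero_less_measure_iff)
  then show ?thesis by (simp add: log_tail_def)
qed (simp add: log_tail_def)

lemma exp_minus_log_tail:
  "0 < prob {\<omega>\<in>space M. x < X \<omega>} \<Longrightarrow> exp (- log_tail M X x) = prob {\<omega>\<in>space M. x < X \<omega>}"
  by (simp add: log_tail_def)

lemma mono_log_tail:
  assumes [measurable]: "X \<in> borel_measurable M" and pos: "\<And>x. 0 < prob {\<omega>\<in>space M. x < X \<omega>}"
  shows "mono (log_tail M X)"
proof (rule monoI)
  fix x y :: real assume "x \<le> y"
  then have "prob {\<omega>\<in>space M. y < X \<omega>} \<le> prob {\<omega>\<in>space M. x < X \<omega>}"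
    by (intro finite_measure_mono) auto
  then show "log_tail M X x \<le> log_tail M X y" using pos by (simp add: log_tail_def)
qed

text \<open>
  If \<open>X\<close> has a continuous law, then \<open>exp (- log_tail M X (X \<omega>))\<close> is uniform, and the claim is that
  \<open>U powr (- \<theta>)\<close> is integrable. An atom at \<open>x\<close> makes \<open>P(X \<ge> x)\<close> larger than \<open>P(X > x)\<close>; regular
  variation controls the difference, because \<open>P(X \<ge> x) \<le> P(X > x / l)\<close> for \<open>l > 1\<close>.
\<close>
lemma exp_moment_log_tail:
  fixes X :: "'a \<Rightarrow> real"
  assumes X[measurable]: "X \<in> borel_measurable M" and pos: "\<And>x. 0 < prob {\<omega>\<in>space M. x < X \<omega>}"
    and rv: "regularly_varying \<rho> (log_tail M X)" and \<rho>: "0 < \<rho>" and \<theta>: "0 < \<theta>" "\<theta> < 1"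
  shows "integrable M (\<lambda>\<omega>. exp (\<theta> * log_tail M X (X \<omega>)))"
proof -
  define \<kappa> where "\<kappa> = sqrt \<theta>"
  have \<kappa>: "0 < \<kappa>" "\<kappa> < 1" "\<kappa> * \<kappa> = \<theta>" using \<theta> by (auto simp: \<kappa>_def)
  define l where "l = (1 / \<kappa>) powr (1 / (2 * \<rho>))"
  have l: "1 < l" unfolding l_def using \<kappa> \<rho> by (intro gr_one_powr) auto
  have "l powr \<rho> = (1 / \<kappa>) powr (1 / 2)" using \<rho> by (simp add: l_def powr_powr)
  also have "\<dots> < (1 / \<kappa>) powr 1" using \<kappa> by (intro powr_less_mono) auto
  finally have "l powr \<rho> < 1 / \<kappa>" using \<kappa> by simp
  then have "\<forall>\<^sub>F x in at_top. log_tail M X (l * x) \<le> 1 / \<kappa> * log_tail M X x"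
    using l by (intro regularly_varying_eventually_le[OF rv]) auto
  from eventually_at_top_scale[OF _ this, of "1 / l"] l
  have "\<forall>\<^sub>F x in at_top. log_tail M X x \<le> 1 / \<kappa> * log_tail M X (x / l)" by simp
  then obtain N where N: "\<And>x. N \<le> x \<Longrightarrow> log_tail M X x \<le> 1 / \<kappa> * log_tail M X (x / l)"
    by (auto simp: eventually_at_top_linorder)
  define x0 where "x0 = max N 1"
  define C where "C = exp (\<kappa> * log_tail M X x0)"
  have mono: "mono (log_tail M X)" by (rule mono_log_tail[OF X pos])
  have C1: "1 \<le> C" using \<kappa> log_tail_nonneg by (simp add: C_def)
  have "integrable M (\<lambda>\<omega>. exp (\<kappa> * (\<kappa> * log_tail M X (X \<omega>))))"
  proof (rule exp_moment_of_tail[where C = C and g = "\<lambda>x. \<kappa> * log_tail M X x"])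
    show "mono (\<lambda>x. \<kappa> * log_tail M X x)"
      using \<kappa> by (intro monoI mult_left_mono monoD[OF mono]) auto
    show "prob {\<omega>\<in>space M. x \<le> X \<omega>} \<le> C * exp (- (\<kappa> * log_tail M X x))" for x
    proof (cases "x0 \<le> x")
      case True
      then have x: "N \<le> x" "x / l < x" using l by (auto simp: x0_def field_simps)
      have "prob {\<omega>\<in>space M. x \<le> X \<omega>} \<le> prob {\<omega>\<in>space M. x / l < X \<omega>}"
        using x by (intro finite_measure_mono) auto
      also have "\<dots> = exp (- log_tail M X (x / l))" by (rule exp_minus_log_tail[OF pos, symmetric])
      also have "\<dots> \<le> 1 * exp (- (\<kappa> * log_tail M X x))" using N[OF x(1)] \<kappa> by (simp add: field_simps)
      also have "\<dots> \<le> C * exp (- (\<kappa> * log_tail M X x))" using C1 by (intro mult_right_mono) auto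
      finally show ?thesis .
    next
      case False
      have "prob {\<omega>\<in>space M. x \<le> X \<omega>} \<le> 1" by simp
      also have "\<dots> \<le> exp (\<kappa> * (log_tail M X x0 - log_tail M X x))"
        using False monoD[OF mono, of x x0] \<kappa> by simp
      also have "\<dots> = C * exp (- (\<kappa> * log_tail M X x))"
        by (simp add: C_def exp_add[symmetric] algebra_simps)
      finally show ?thesis .
    qed
  qed (use \<kappa> C1 log_tail_nonneg in auto)
  then show ?thesis by (simp add: \<kappa>(3) mult.assoc[symmetric])
qed

end

section \<open>Perpetuities\<close>

lemma perpetuity_prob_ge:
  assumes "prob_space \<Omega>" "prob_space \<Omega>'" and [measurable]: "M \<in> borel_measurable \<Omega>" "Q \<in> borel_measurable \<Omega>"
    and perp: "is_perpetuity \<Omega> M Q \<Omega>' R"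
    and A: "A \<in> sets \<Omega>" and B: "B \<in> sets \<Omega>'"
    and AB: "\<And>\<omega> \<omega>'. \<omega> \<in> A \<Longrightarrow> \<omega>' \<in> B \<Longrightarrow> x < M \<omega> * R \<omega>' + Q \<omega>"
  shows "measure \<Omega> A * measure \<Omega>' B \<le> \<P>(\<omega> in \<Omega>'. R \<omega> > x)"
proof -
  interpret P: prob_space \<Omega> by fact
  interpret P': prob_space \<Omega>' by fact
  interpret PP: pair_prob_space \<Omega> \<Omega>' ..
  have [measurable]: "R \<in> borel_measurable \<Omega>'" using perp by (simp add: is_perpetuity_def)
  have "measure \<Omega> A * measure \<Omega>' B = PP.prob (A \<times> B)"
    using A B by (simp add: measure_def P'.emeasure_pair_measure_Times enn2real_mult)
  also have "\<dots> \<le> PP.prob {p\<in>space (\<Omega> \<Otimes>\<^sub>M \<Omega>'). x < M (fst p) * R (snd p) + Q (fst p)}"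
    using AB sets.sets_into_space[OF A] sets.sets_into_space[OF B]
    by (intro PP.finite_measure_mono) (auto simp: space_pair_measure)
  also have "\<dots> = measure (distr (\<Omega> \<Otimes>\<^sub>M \<Omega>') borel (\<lambda>(\<omega>, \<omega>'). M \<omega> * R \<omega>' + Q \<omega>)) {x<..}"
    by (subst measure_distr) (auto intro!: arg_cong[where f = PP.prob])
  also have "\<dots> = measure (distr \<Omega>' borel R) {x<..}" using perp by (simp add: is_perpetuity_def)
  also have "\<dots> = \<P>(\<omega> in \<Omega>'. R \<omega> > x)"
    by (subst measure_distr) (auto intro!: arg_cong[where f = P'.prob])
  finally show ?thesis .
qed

lemma perpetuity_integral:
  fixes \<phi> :: "real \<Rightarrow> real"
  assumes "prob_space \<Omega>" "prob_space \<Omega>'" and [measurable]: "M \<in> borel_measurable \<Omega>" "Q \<in> borel_measurable \<Omega>"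
    and perp: "is_perpetuity \<Omega> M Q \<Omega>' R"
    and [measurable]: "\<phi> \<in> borel_measurable borel" and bounded: "\<And>x. \<bar>\<phi> x\<bar> \<le> b"
  shows "integrable \<Omega>' (\<lambda>\<omega>'. \<integral>\<omega>. \<phi> (M \<omega> * R \<omega>' + Q \<omega>) \<partial>\<Omega>)"
    and "(\<integral>\<omega>'. (\<integral>\<omega>. \<phi> (M \<omega> * R \<omega>' + Q \<omega>) \<partial>\<Omega>) \<partial>\<Omega>') = (\<integral>\<omega>'. \<phi> (R \<omega>') \<partial>\<Omega>')"
proof -
  interpret P: prob_space \<Omega> by fact
  interpret P': prob_space \<Omega>' by fact
  interpret PP: pair_prob_space \<Omega> \<Omega>' ..
  have [measurable]: "R \<in> borel_measurable \<Omega>'" using perp by (simp add: is_perpetuity_def)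
  have int: "integrable (\<Omega> \<Otimes>\<^sub>M \<Omega>') (\<lambda>(\<omega>, \<omega>'). \<phi> (M \<omega> * R \<omega>' + Q \<omega>))"
    using bounded by (intro PP.integrable_const_bound[where B = b]) auto
  show "integrable \<Omega>' (\<lambda>\<omega>'. \<integral>\<omega>. \<phi> (M \<omega> * R \<omega>' + Q \<omega>) \<partial>\<Omega>)"
    by (rule PP.integrable_snd[OF int])
  have "(\<integral>\<omega>'. (\<integral>\<omega>. \<phi> (M \<omega> * R \<omega>' + Q \<omega>) \<partial>\<Omega>) \<partial>\<Omega>')
      = (\<integral>p. (case p of (\<omega>, \<omega>') \<Rightarrow> \<phi> (M \<omega> * R \<omega>' + Q \<omega>)) \<partial>(\<Omega> \<Otimes>\<^sub>M \<Omega>'))"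
    by (rule PP.integral_snd[OF int])
  also have "\<dots> = (\<integral>r. \<phi> r \<partial>(distr (\<Omega> \<Otimes>\<^sub>M \<Omega>') borel (\<lambda>(\<omega>, \<omega>'). M \<omega> * R \<omega>' + Q \<omega>)))"
    by (subst integral_distr) (auto simp: case_prod_beta')
  also have "\<dots> = (\<integral>r. \<phi> r \<partial>(distr \<Omega>' borel R))" using perp by (simp add: is_perpetuity_def)
  also have "\<dots> = (\<integral>\<omega>'. \<phi> (R \<omega>') \<partial>\<Omega>')" by (subst integral_distr) auto
  finally show "(\<integral>\<omega>'. (\<integral>\<omega>. \<phi> (M \<omega> * R \<omega>' + Q \<omega>) \<partial>\<Omega>) \<partial>\<Omega>') = (\<integral>\<omega>'. \<phi> (R \<omega>') \<partial>\<Omega>')" .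
qed

text \<open>
  The negative part of \<open>M R + Q\<close> is at most that of \<open>R\<close>, and strictly smaller where \<open>R < 0\<close>. As both
  have the same law, comparing the means of a bounded strictly increasing function of
  them leaves only \<open>R \<ge> 0\<close>.
\<close>
lemma perpetuity_nonneg:
  assumes "prob_space \<Omega>" "prob_space \<Omega>'" and [measurable]: "M \<in> borel_measurable \<Omega>" "Q \<in> borel_measurable \<Omega>"
    and perp: "is_perpetuity \<Omega> M Q \<Omega>' R"
    and M: "AE \<omega> in \<Omega>. 0 \<le> M \<omega> \<and> M \<omega> < 1" and Q: "AE \<omega> in \<Omega>. 0 \<le> Q \<omega>"
  shows "AE \<omega> in \<Omega>'. 0 \<le> R \<omega>"
proof -
  interpret P: prob_space \<Omega> by fact
  interpret P': prob_space \<Omega>' by fact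
  have [measurable]: "R \<in> borel_measurable \<Omega>'" using perp by (simp add: is_perpetuity_def)
  define \<phi> :: "real \<Rightarrow> real" where "\<phi> y = arctan (max 0 (- y))" for y
  have [measurable]: "\<phi> \<in> borel_measurable borel" unfolding \<phi>_def by measurable
  have bounded: "\<bar>\<phi> y\<bar> \<le> pi / 2" for y
    using arctan_bounded[of "max 0 (- y)"] by (auto simp: \<phi>_def abs_le_iff less_imp_le)
  define \<psi> where "\<psi> y = (\<integral>\<omega>. \<phi> (M \<omega> * y + Q \<omega>) \<partial>\<Omega>)" for y
  have int: "integrable \<Omega> (\<lambda>\<omega>. \<phi> (M \<omega> * y + Q \<omega>))" for y
    using bounded by (intro P.integrable_const_bound[where B = "pi / 2"]) auto
  have intR: "integrable \<Omega>' (\<lambda>\<omega>'. \<phi> (R \<omega>'))"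
    using bounded by (intro P'.integrable_const_bound[where B = "pi / 2"]) auto
  have le: "\<psi> y \<le> \<phi> y" for y
  proof (cases "y < 0")
    case True
    have "\<psi> y \<le> (\<integral>\<omega>. \<phi> y \<partial>\<Omega>)" unfolding \<psi>_def
    proof (rule integral_mono_AE[OF int])
      show "AE \<omega> in \<Omega>. \<phi> (M \<omega> * y + Q \<omega>) \<le> \<phi> y"
        using M Q
      proof eventually_elim
        case (elim \<omega>)
        have "1 * y \<le> M \<omega> * y" using elim True by (intro mult_right_mono_neg) auto
        then show ?case using elim by (auto simp: \<phi>_def arctan_monotone' max_def)
      qed
    qed simp
    then show ?thesis by (simp add: P.prob_space)
  next
    case False
    have "AE \<omega> in \<Omega>. \<phi> (M \<omega> * y + Q \<omega>) = 0"
      using M Q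
    proof eventually_elim
      case (elim \<omega>)
      have "0 \<le> M \<omega> * y" using elim False by (intro mult_nonneg_nonneg) auto
      then show ?case using elim by (simp add: \<phi>_def max_def)
    qed
    then have "\<psi> y = 0" unfolding \<psi>_def by (subst integral_cong_AE[where g = "\<lambda>_. 0"]) auto
    then show ?thesis using False by (simp add: \<phi>_def max_def)
  qed
  have less: "\<psi> y < \<phi> y" if "y < 0" for y
  proof -
    have "\<psi> y < (\<integral>\<omega>. \<phi> y \<partial>\<Omega>)" unfolding \<psi>_def
    proof (rule P.integral_less_AE_space[OF int])
      show "AE \<omega> in \<Omega>. \<phi> (M \<omega> * y + Q \<omega>) < \<phi> y"
        using M Q
      proof eventually_elim
        case (elim \<omega>)
        have "1 * y < M \<omega> * y" using elim that by (intro mult_strict_right_mono_neg) auto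
        then have "y < M \<omega> * y + Q \<omega>" using elim by linarith
        then have "max 0 (- (M \<omega> * y + Q \<omega>)) < max 0 (- y)" using that unfolding max_def by auto
        then show ?case by (simp add: \<phi>_def arctan_monotone)
      qed
    qed (auto simp: P.emeasure_space_1)
    then show ?thesis by (simp add: P.prob_space)
  qed
  note pi = perpetuity_integral[where \<phi> = \<phi> and b = "pi / 2", OF assms(1-5) _ bounded, folded \<psi>_def]
  have "\<not> (emeasure \<Omega>' {\<omega>\<in>space \<Omega>'. R \<omega> < 0} \<noteq> 0)"
  proof
    assume ne: "emeasure \<Omega>' {\<omega>\<in>space \<Omega>'. R \<omega> < 0} \<noteq> 0"
    have "(\<integral>\<omega>'. \<psi> (R \<omega>') \<partial>\<Omega>') < (\<integral>\<omega>'. \<phi> (R \<omega>') \<partial>\<Omega>')"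
      by (rule P'.integral_less_AE[OF pi(1) intR ne]) (auto simp: le dest!: less)
    then show False using pi(2) by simp
  qed
  then show ?thesis by (subst AE_iff_measurable[OF _ refl]) (auto simp: not_le)
qed

section \<open>Upper bound for arbitrary dependence\<close>

text \<open>
  The hypotheses on the marginals in the form in which they are used: no logarithm below is taken
  of \<open>0\<close>, and \<open>M < 1\<close> almost surely.
\<close>
locale perpetuity_input = prob_space P for P :: "'a measure" +
  fixes M Q :: "'a \<Rightarrow> real" and \<alpha> r \<gamma> :: real
  assumes M_measurable[measurable]: "M \<in> borel_measurable P"
    and Q_measurable[measurable]: "Q \<in> borel_measurable P"
    and AE_M: "AE \<omega> in P. 0 \<le> M \<omega> \<and> M \<omega> < 1" and AE_Q: "AE \<omega> in P. 0 \<le> Q \<omega>"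
    and \<alpha>_gt_1: "1 < \<alpha>" and r_gt_1: "1 < r"
    and T_tail_pos: "0 < prob {\<omega>\<in>space P. x < 1 / (1 - M \<omega>)}"
    and Q_tail_pos: "0 < prob {\<omega>\<in>space P. x < Q \<omega>}"
    and rv_T: "regularly_varying (r - 1) (log_tail P (\<lambda>\<omega>. 1 / (1 - M \<omega>)))"
    and rv_Q: "regularly_varying \<alpha> (log_tail P Q)"
    and \<gamma>_eq: "\<gamma> = \<alpha> * r / (\<alpha> + r - 1)"
begin

abbreviation k :: "real \<Rightarrow> real" where "k \<equiv> log_tail P Q"

abbreviation m :: "real \<Rightarrow> real" where "m \<equiv> log_tail P (\<lambda>\<omega>. 1 / (1 - M \<omega>))"

sublocale growth_pair k m \<alpha> "r - 1" \<gamma>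
  by unfold_locales
    (use \<alpha>_gt_1 r_gt_1 T_tail_pos Q_tail_pos rv_T rv_Q \<gamma>_eq in \<open>auto intro!: mono_log_tail log_tail_nonneg\<close>)

lemma h_co_eq: "h_co P M Q = h"
proof
  fix x
  have "- t * ln (min (prob {\<omega>\<in>space P. t < 1 / (1 - M \<omega>)}) (prob {\<omega>\<in>space P. x / t < Q \<omega>})) = cost x t"
    if "1 \<le> t" for t
  proof -
    have ln_min: "ln (min a b) = min (ln a) (ln b)" if "0 < a" "0 < b" for a b :: real
      using that by (auto simp: min_def)
    have "- min a b = max (- a) (- b)" for a b :: real by (auto simp: min_def max_def)
    then show ?thesis
      by (simp add: ln_min[OF T_tail_pos Q_tail_pos] cost_def log_tail_def mult_minus_right[symmetric] del: mult_minus_right)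
  qed
  then show "h_co P M Q x = h x" unfolding h_co_def h_def by (intro INF_cong) auto
qed

lemma mono_potential:
  assumes X: "0 < X" and \<epsilon>: "\<epsilon> < 1 / 3"
  shows "mono (potential \<epsilon> X)"
proof (rule monoI)
  fix x y :: real assume "x \<le> y"
  then have "max 0 (min x (2 * X)) / X \<le> max 0 (min y (2 * X)) / X"
    using X by (intro divide_right_mono) auto
  then have "(max 0 (min x (2 * X)) / X) powr \<gamma> \<le> (max 0 (min y (2 * X)) / X) powr \<gamma>"
    using X \<gamma>_gt_1 by (intro powr_mono2) auto
  then show "potential \<epsilon> X x \<le> potential \<epsilon> X y"
    unfolding potential_def using \<epsilon> c_pos h_nonneg by (intro mult_left_mono) auto
qed

lemma potential_le:
  assumes "0 < X" "\<epsilon> < 1 / 3"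
  shows "potential \<epsilon> X x \<le> potential \<epsilon> X (2 * X)"
proof (cases "x \<le> 2 * X")
  case True
  then show ?thesis by (rule monoD[OF mono_potential[OF assms]])
qed (simp add: potential_def)

lemma borel_measurable_potential[measurable]: "potential \<epsilon> X \<in> borel_measurable borel"
  unfolding potential_def[abs_def] by measurable

lemma integrable_exp_potential:
  assumes "0 < X" "\<epsilon> < 1 / 3" and [measurable]: "Y \<in> borel_measurable P"
  shows "integrable P (\<lambda>\<omega>. exp (potential \<epsilon> X (Y \<omega>)))"
  using potential_le[OF assms(1,2)] by (intro integrable_const_bound[where B = "exp (potential \<epsilon> X (2 * X))"]) auto

text \<open>
  Under any coupling of \<open>M\<close> and \<open>Q\<close>, the inequality \<open>exp (max a b) \<le> exp a + exp b\<close> bounds the mean by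
  the sum \<open>I\<close> of two marginal exponential moments, and \<open>B\<close> is chosen such that \<open>exp (- B) * I \<le> 1 / 2\<close>.
\<close>
lemma potential_contraction:
  assumes \<epsilon>: "0 < \<epsilon>" "\<epsilon> < 1 / 3" and \<delta>: "0 < \<delta>"
  shows "\<forall>\<^sub>F X in at_top. \<forall>y\<in>{\<delta> * X..2 * X}.
    (\<integral>\<omega>. exp (potential \<epsilon> X (M \<omega> * y + Q \<omega>)) \<partial>P) \<le> exp (potential \<epsilon> X y) / 2"
proof -
  define W where "W \<omega> = exp ((1 - \<epsilon>) * m (1 / (1 - M \<omega>))) + exp ((1 - \<epsilon>) * k (Q \<omega>))" for \<omega>
  have W: "integrable P W"
    unfolding W_def using \<epsilon> r_gt_1 \<alpha>_gt_1
    by (intro Bochner_Integration.integrable_add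
        exp_moment_log_tail[OF _ T_tail_pos rv_T] exp_moment_log_tail[OF _ Q_tail_pos rv_Q]) auto
  define I where "I = (\<integral>\<omega>. W \<omega> \<partial>P)"
  define B where "B = max 0 (ln (2 * I))"
  have I0: "0 \<le> I" unfolding I_def W_def by (intro integral_nonneg_AE) auto
  have BI: "exp (- B) * I \<le> 1 / 2"
  proof (cases "I = 0")
    case False
    then have "0 < 2 * I" using I0 by simp
    have "exp (- B) \<le> exp (- ln (2 * I))" by (simp add: B_def)
    also have "\<dots> = 1 / (2 * I)" using \<open>0 < 2 * I\<close> by (simp add: exp_minus inverse_eq_divide)
    finally have "exp (- B) * I \<le> 1 / (2 * I) * I" using I0 by (rule mult_right_mono)
    then show ?thesis using False by simp
  qed simp
  have "0 \<le> B" by (simp add: B_def)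
  show ?thesis
    using potential_increment[OF \<epsilon> \<delta> \<open>0 \<le> B\<close>] eventually_gt_at_top[of 0]
  proof eventually_elim
    case (elim X)
    show ?case
    proof
      fix y assume y: "y \<in> {\<delta> * X..2 * X}"
      have "(\<integral>\<omega>. exp (potential \<epsilon> X (M \<omega> * y + Q \<omega>)) \<partial>P) \<le> (\<integral>\<omega>. exp (potential \<epsilon> X y) * exp (- B) * W \<omega> \<partial>P)"
      proof (rule integral_mono_AE)
        show "integrable P (\<lambda>\<omega>. exp (potential \<epsilon> X (M \<omega> * y + Q \<omega>)))"
          using elim(2) \<epsilon>(2) by (intro integrable_exp_potential) auto
        show "integrable P (\<lambda>\<omega>. exp (potential \<epsilon> X y) * exp (- B) * W \<omega>)"
          using W by simp
        show "AE \<omega> in P. exp (potential \<epsilon> X (M \<omega> * y + Q \<omega>)) \<le> exp (potential \<epsilon> X y) * exp (- B) * W \<omega>"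
          using AE_M AE_Q
        proof eventually_elim
          case (elim \<omega>)
          define t where "t = 1 / (1 - M \<omega>)"
          have t: "1 \<le> t" "1 - 1 / t = M \<omega>" using elim by (auto simp: t_def)
          have "potential \<epsilon> X ((1 - 1 / t) * y + Q \<omega>) - potential \<epsilon> X y \<le> (1 - \<epsilon>) * max (m t) (k (Q \<omega>)) - B"
            using \<open>\<forall>y\<in>_. _\<close> y elim t(1) by blast
          then have "potential \<epsilon> X (M \<omega> * y + Q \<omega>) \<le> potential \<epsilon> X y + - B + (1 - \<epsilon>) * max (m t) (k (Q \<omega>))"
            unfolding t(2) by linarith
          then have "exp (potential \<epsilon> X (M \<omega> * y + Q \<omega>)) \<le> exp (potential \<epsilon> X y + - B + (1 - \<epsilon>) * max (m t) (k (Q \<omega>)))"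
            by simp
          also have "\<dots> = exp (potential \<epsilon> X y) * exp (- B) * exp ((1 - \<epsilon>) * max (m t) (k (Q \<omega>)))"
            by (simp only: exp_add)
          also have "\<dots> \<le> exp (potential \<epsilon> X y) * exp (- B) * W \<omega>"
            by (intro mult_left_mono) (auto simp: W_def t_def[symmetric] max_def add_increasing add_increasing2)
          finally show ?case .
        qed
      qed
      also have "\<dots> = exp (potential \<epsilon> X y) * (exp (- B) * I)" by (simp add: I_def mult.assoc)
      also have "\<dots> \<le> exp (potential \<epsilon> X y) * (1 / 2)" using BI by (intro mult_left_mono) auto
      finally show "(\<integral>\<omega>. exp (potential \<epsilon> X (M \<omega> * y + Q \<omega>)) \<partial>P) \<le> exp (potential \<epsilon> X y) / 2" by simp
    qed
  qed
qed

text \<open>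
  Let \<open>\<phi> = exp (potential \<epsilon> X \<cdot>)\<close>. In the equation \<open>E \<phi>(R) = E \<phi>(M R + Q)\<close> the contributions of
  \<open>R \<ge> 2 * X\<close> cancel up to a favourable sign, as \<open>\<phi>\<close> is maximal there; below \<open>2 * X\<close> the contraction
  turns the equation into \<open>E (\<phi>(R); R < 2 * X) \<le> \<phi> (\<delta> * X)\<close>.
\<close>
lemma perpetuity_band:
  fixes R :: "'b \<Rightarrow> real"
  assumes \<epsilon>: "0 < \<epsilon>" "\<epsilon> < 1 / 3" and \<delta>: "0 < \<delta>" "\<delta> < 1"
    and R: "prob_space \<Omega>" "is_perpetuity P M Q \<Omega> R"
  shows "\<forall>\<^sub>F X in at_top. \<P>(\<omega> in \<Omega>. X \<le> R \<omega> \<and> R \<omega> < 2 * X)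
    \<le> exp (- ((1 - 3 * \<epsilon>) * (1 - \<delta> powr \<gamma>) * c * h X))"
  using potential_contraction[OF \<epsilon> \<delta>(1)] eventually_gt_at_top[of 0]
proof eventually_elim
  case (elim X)
  interpret \<Omega>: prob_space \<Omega> by fact
  have [measurable]: "R \<in> borel_measurable \<Omega>" using R(2) by (simp add: is_perpetuity_def)
  define \<phi> where "\<phi> y = exp (potential \<epsilon> X y)" for y
  have [measurable]: "\<phi> \<in> borel_measurable borel" unfolding \<phi>_def by measurable
  have \<phi>0: "0 < \<phi> y" for y by (simp add: \<phi>_def)
  have \<phi>_mono: "\<phi> x \<le> \<phi> y" if "x \<le> y" for x y
    using monoD[OF mono_potential[OF elim(2) \<epsilon>(2)] that] by (simp add: \<phi>_def)
  have \<phi>_le: "\<phi> y \<le> \<phi> (2 * X)" for y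
    using potential_le[OF elim(2) \<epsilon>(2)] by (simp add: \<phi>_def)
  have bounded: "\<bar>\<phi> y\<bar> \<le> \<phi> (2 * X)" for y using \<phi>0[of y] \<phi>_le[of y] by simp
  define f where "f y = (\<integral>\<omega>. \<phi> (M \<omega> * y + Q \<omega>) \<partial>P)" for y
  define g where "g y = (if y < 2 * X then (\<phi> y + \<phi> (\<delta> * X)) / 2 else \<phi> y)" for y
  have [measurable]: "g \<in> borel_measurable borel" unfolding g_def by measurable
  have int: "integrable P (\<lambda>\<omega>. \<phi> (M \<omega> * y + Q \<omega>))" for y
    unfolding \<phi>_def using elim(2) \<epsilon>(2) by (intro integrable_exp_potential) auto
  have contr: "f y \<le> \<phi> y / 2" if "y \<in> {\<delta> * X..2 * X}" for y
    using elim(1) that by (simp add: f_def \<phi>_def)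
  have fg: "f y \<le> g y" for y
  proof (cases "y < 2 * X")
    case True
    have "f y \<le> (\<phi> y + \<phi> (\<delta> * X)) / 2"
    proof (cases "\<delta> * X \<le> y")
      case True
      then have "f y \<le> \<phi> y / 2" using \<open>y < 2 * X\<close> by (intro contr) auto
      then show ?thesis using \<phi>0[of "\<delta> * X"] by simp
    next
      case False
      have "f y \<le> f (\<delta> * X)" unfolding f_def
      proof (rule integral_mono_AE[OF int int])
        show "AE \<omega> in P. \<phi> (M \<omega> * y + Q \<omega>) \<le> \<phi> (M \<omega> * (\<delta> * X) + Q \<omega>)"
          using AE_M
        proof eventually_elim
          case (elim \<omega>)
          have "M \<omega> * y \<le> M \<omega> * (\<delta> * X)" using elim False by (intro mult_left_mono) auto
          then show ?case by (intro \<phi>_mono) simp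
        qed
      qed
      also have "\<delta> * X \<le> 2 * X" using \<delta> elim(2) by (intro mult_right_mono) auto
      then have "f (\<delta> * X) \<le> \<phi> (\<delta> * X) / 2" by (intro contr) auto
      finally show ?thesis using \<phi>0[of y] by simp
    qed
    then show ?thesis using True by (simp add: g_def)
  next
    case False
    have "f y \<le> (\<integral>\<omega>. \<phi> y \<partial>P)" unfolding f_def
    proof (rule integral_mono[OF int])
      show "\<phi> (M \<omega> * y + Q \<omega>) \<le> \<phi> y" for \<omega>
        using \<phi>_le[of "M \<omega> * y + Q \<omega>"] \<phi>_mono[of "2 * X" y] False by simp
    qed simp
    then show ?thesis using False by (simp add: g_def prob_space)
  qed
  have g_bounded: "\<bar>g y\<bar> \<le> \<phi> (2 * X)" for y
    using \<phi>0[of y] \<phi>0[of "\<delta> * X"] \<phi>_le[of y] \<phi>_le[of "\<delta> * X"] by (auto simp: g_def)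
  have int\<phi>: "integrable \<Omega> (\<lambda>\<omega>. \<phi> (R \<omega>))"
    using bounded by (intro \<Omega>.integrable_const_bound[where B = "\<phi> (2 * X)"]) auto
  have intg: "integrable \<Omega> (\<lambda>\<omega>. g (R \<omega>))"
    using g_bounded by (intro \<Omega>.integrable_const_bound[where B = "\<phi> (2 * X)"]) auto
  note perp = perpetuity_integral[where \<phi> = \<phi> and b = "\<phi> (2 * X)", OF prob_space_axioms R(1) M_measurable Q_measurable R(2) _ bounded, folded f_def]
  have "(\<integral>\<omega>. \<phi> (R \<omega>) \<partial>\<Omega>) = (\<integral>\<omega>. f (R \<omega>) \<partial>\<Omega>)" using perp(2) by simp
  also have "\<dots> \<le> (\<integral>\<omega>. g (R \<omega>) \<partial>\<Omega>)" using perp(1) intg fg by (intro integral_mono) auto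
  finally have le0: "(\<integral>\<omega>. \<phi> (R \<omega>) - g (R \<omega>) \<partial>\<Omega>) \<le> 0" using int\<phi> intg by simp
  define S where "S = {\<omega>\<in>space \<Omega>. X \<le> R \<omega> \<and> R \<omega> < 2 * X}"
  have [measurable]: "S \<in> sets \<Omega>" by (simp add: S_def)
  have intS: "integrable \<Omega> (indicator S :: 'b \<Rightarrow> real)"
    by (rule \<Omega>.integrable_const_bound[where B = 1]) auto
  then have "(\<integral>\<omega>. \<phi> X * indicator S \<omega> - \<phi> (\<delta> * X) \<partial>\<Omega>) = \<phi> X * \<Omega>.prob S - \<phi> (\<delta> * X)"
    by (subst Bochner_Integration.integral_diff) (auto simp: \<Omega>.prob_space)
  then have "(\<phi> X * \<Omega>.prob S - \<phi> (\<delta> * X)) / 2 = (\<integral>\<omega>. (\<phi> X * indicator S \<omega> - \<phi> (\<delta> * X)) / 2 \<partial>\<Omega>)"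
    by simp
  also have "\<dots> \<le> (\<integral>\<omega>. \<phi> (R \<omega>) - g (R \<omega>) \<partial>\<Omega>)"
  proof (rule integral_mono)
    fix \<omega> assume \<omega>: "\<omega> \<in> space \<Omega>"
    show "(\<phi> X * indicator S \<omega> - \<phi> (\<delta> * X)) / 2 \<le> \<phi> (R \<omega>) - g (R \<omega>)"
    proof (cases "\<omega> \<in> S")
      case True
      then have "g (R \<omega>) = (\<phi> (R \<omega>) + \<phi> (\<delta> * X)) / 2" "\<phi> X \<le> \<phi> (R \<omega>)"
        using \<phi>_mono[of X "R \<omega>"] by (simp_all add: S_def g_def)
      then show ?thesis using True by (simp add: field_simps)
    next
      case False
      then show ?thesis using \<phi>0[of "R \<omega>"] \<phi>0[of "\<delta> * X"] by (simp add: g_def field_simps)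
    qed
  qed (use int\<phi> intg intS in auto)
  finally have "\<phi> X * \<Omega>.prob S \<le> \<phi> (\<delta> * X)" using le0 by simp
  then have "\<Omega>.prob S \<le> \<phi> (\<delta> * X) / \<phi> X" using \<phi>0[of X] by (simp add: field_simps)
  also have "\<dots> = exp (potential \<epsilon> X (\<delta> * X) - potential \<epsilon> X X)" by (simp add: \<phi>_def exp_diff)
  also have "potential \<epsilon> X (\<delta> * X) - potential \<epsilon> X X = - ((1 - 3 * \<epsilon>) * (1 - \<delta> powr \<gamma>) * c * h X)"
  proof -
    have "\<delta> * X \<le> 2 * X" "0 \<le> \<delta> * X" using \<delta> elim(2) by (auto intro!: mult_right_mono)
    then have "max 0 (min (\<delta> * X) (2 * X)) / X = \<delta>" "max 0 (min X (2 * X)) / X = 1"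
      using elim(2) by (simp_all add: max_absorb2 min_absorb1)
    then show ?thesis unfolding potential_def by (simp add: algebra_simps)
  qed
  finally show ?case by (simp add: S_def)
qed

text \<open>
  The bands \<open>[2 ^ n * x, 2 ^ (n + 1) * x)\<close> cover the tail, and their probabilities are
  dominated by a geometric series because \<open>h (2 ^ n * x) \<ge> 2 ^ n * h x\<close>.
\<close>
lemma perpetuity_tail_le:
  fixes R :: "'b \<Rightarrow> real"
  assumes b: "b < c" and R: "prob_space \<Omega>" "is_perpetuity P M Q \<Omega> R"
  shows "\<forall>\<^sub>F x in at_top. \<P>(\<omega> in \<Omega>. R \<omega> > x) \<le> exp (- (b * h x))"
proof -
  interpret \<Omega>: prob_space \<Omega> by fact
  have [measurable]: "R \<in> borel_measurable \<Omega>" using R(2) by (simp add: is_perpetuity_def)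
  define b' where "b' = (max b 0 + c) / 2"
  have b': "b < b'" "b' < c" "0 < b'" using b c_pos by (auto simp: b'_def max_def)
  have "((\<lambda>\<epsilon>. (1 - 3 * \<epsilon>) * (1 - \<epsilon>) * c) \<longlongrightarrow> (1 - 3 * 0) * (1 - 0) * c) (at_right 0)"
    by (intro tendsto_intros)
  then have "\<forall>\<^sub>F \<epsilon> in at_right 0. b' < (1 - 3 * \<epsilon>) * (1 - \<epsilon>) * c"
    using b' by (intro order_tendstoD(1)) auto
  moreover have "\<forall>\<^sub>F \<epsilon> in at_right (0::real). \<epsilon> \<in> {0<..<1/3}"
    by (rule eventually_at_rightI[of 0 "1/3"]) auto
  ultimately have "\<forall>\<^sub>F \<epsilon> in at_right 0. b' < (1 - 3 * \<epsilon>) * (1 - \<epsilon>) * c \<and> \<epsilon> \<in> {0<..<1/3}"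
    by (rule eventually_conj)
  then obtain \<epsilon> where \<epsilon>: "b' < (1 - 3 * \<epsilon>) * (1 - \<epsilon>) * c" "0 < \<epsilon>" "\<epsilon> < 1 / 3"
    using eventually_happens'[OF trivial_limit_at_right_real] by fastforce
  \<comment> \<open>With this choice \<open>1 - \<delta> powr \<gamma> = 1 - \<epsilon>\<close>, so that one small parameter remains.\<close>
  define \<delta> where "\<delta> = \<epsilon> powr (1 / \<gamma>)"
  have \<gamma>0: "0 < \<gamma>" using \<gamma>_gt_1 by linarith
  then have \<delta>\<gamma>: "\<delta> powr \<gamma> = \<epsilon>" using \<epsilon> unfolding \<delta>_def powr_powr by simp
  have \<delta>: "0 < \<delta>" "\<delta> < 1"
    using \<epsilon> powr_less_mono2[of "1 / \<gamma>" \<epsilon> 1] \<gamma>0 by (auto simp: \<delta>_def)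
  have "(2::real) powr 1 < 2 powr \<gamma>" using \<gamma>_gt_1 by (intro powr_less_mono) auto
  then have it: "\<forall>\<^sub>F x in at_top. \<forall>n. 2 ^ n * h x \<le> h (2 ^ n * x)"
    by (intro regularly_varying_iterate[OF rv_h]) auto
  obtain X0 where X0: "\<And>X. X0 \<le> X \<Longrightarrow> \<P>(\<omega> in \<Omega>. X \<le> R \<omega> \<and> R \<omega> < 2 * X) \<le> exp (- ((1 - 3 * \<epsilon>) * (1 - \<delta> powr \<gamma>) * c * h X))"
    using perpetuity_band[OF \<epsilon>(2,3) \<delta> R] by (auto simp: eventually_at_top_linorder)
  have band: "\<P>(\<omega> in \<Omega>. X \<le> R \<omega> \<and> R \<omega> < 2 * X) \<le> exp (- (b' * h X))" if "X0 \<le> X" for X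
  proof -
    have "b' * h X \<le> (1 - 3 * \<epsilon>) * (1 - \<delta> powr \<gamma>) * c * h X"
      unfolding \<delta>\<gamma> using \<epsilon> h_nonneg by (intro mult_right_mono) auto
    then show ?thesis using X0[OF that] by (auto intro: order_trans)
  qed
  show ?thesis
    using it eventually_ge_at_top[of "max X0 1"] eventually_h_ge[of "ln 2 / b'"] eventually_h_ge[of "ln 2 / (b' - b)"]
  proof eventually_elim
    case (elim x)
    have x: "X0 \<le> x" "1 \<le> x" using elim(2) by auto
    define p where "p = exp (- (b' * h x))"
    have "ln 2 \<le> b' * h x" using elim(3) b' by (simp add: pos_divide_le_eq mult.commute)
    then have "p \<le> exp (- ln 2)" by (simp add: p_def)
    then have p: "0 < p" "p \<le> 1 / 2" by (auto simp: p_def exp_minus)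
    define A where "A n = {\<omega>\<in>space \<Omega>. 2 ^ n * x \<le> R \<omega> \<and> R \<omega> < 2 * (2 ^ n * x)}" for n
    have PA: "\<Omega>.prob (A n) \<le> p * p ^ n" for n
    proof -
      have "1 * x \<le> 2 ^ n * x" using x by (intro mult_right_mono) auto
      then have "\<Omega>.prob (A n) \<le> exp (- (b' * h (2 ^ n * x)))" unfolding A_def using x by (intro band) linarith
      also have "\<dots> \<le> exp (- (b' * (real (Suc n) * h x)))"
      proof -
        have "real (Suc n) \<le> 2 ^ n" by (induction n) auto
        then have "real (Suc n) * h x \<le> 2 ^ n * h x" using h_nonneg by (intro mult_right_mono)
        also have "\<dots> \<le> h (2 ^ n * x)" using elim(1) by blast
        finally show ?thesis using b' by simp
      qed
      also have "b' * (real (Suc n) * h x) = real (Suc n) * (b' * h x)" by simp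
      also have "exp (- (real (Suc n) * (b' * h x))) = p ^ Suc n"
        unfolding p_def exp_of_nat_mult[symmetric] by simp
      finally show ?thesis by simp
    qed
    have sm: "summable (\<lambda>n. p * p ^ n)" using p by (intro summable_mult summable_geometric) auto
    have smA: "summable (\<lambda>n. \<Omega>.prob (A n))"
      by (rule summable_comparison_test'[OF sm, of 0]) (use PA in auto)
    have "{\<omega>\<in>space \<Omega>. x < R \<omega>} \<subseteq> (\<Union>n. A n)"
    proof
      fix \<omega> assume \<omega>: "\<omega> \<in> {\<omega>\<in>space \<Omega>. x < R \<omega>}"
      have "\<exists>n. R \<omega> < 2 ^ n * x"
      proof -
        obtain n where "R \<omega> < 2 ^ n" using real_arch_pow[of 2 "R \<omega>"] by auto
        also have "(2::real) ^ n * 1 \<le> 2 ^ n * x" using x by (intro mult_left_mono) auto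
        finally show ?thesis by auto
      qed
      then have N: "R \<omega> < 2 ^ (LEAST n. R \<omega> < 2 ^ n * x) * x" by (rule LeastI_ex)
      define N where "N = (LEAST n. R \<omega> < 2 ^ n * x)"
      have "N \<noteq> 0" using N \<omega> unfolding N_def[symmetric] by (intro notI) auto
      then obtain n where n: "N = Suc n" by (cases N) auto
      then have "\<not> R \<omega> < 2 ^ n * x" unfolding N_def by (intro not_less_Least) simp
      then have "\<omega> \<in> A n" using N \<omega> unfolding N_def[symmetric] n by (simp add: A_def mult.assoc)
      then show "\<omega> \<in> (\<Union>n. A n)" by blast
    qed
    then have "\<P>(\<omega> in \<Omega>. R \<omega> > x) \<le> \<Omega>.prob (\<Union>n. A n)"
      by (intro \<Omega>.finite_measure_mono) (auto simp: A_def)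
    also have "\<dots> \<le> (\<Sum>n. \<Omega>.prob (A n))"
      by (rule \<Omega>.finite_measure_subadditive_countably[OF _ smA]) (auto simp: A_def)
    also have "\<dots> \<le> (\<Sum>n. p * p ^ n)" by (rule suminf_le[OF PA smA sm])
    also have "\<dots> = p * (1 / (1 - p))"
      using p by (subst suminf_mult) (auto simp: summable_geometric suminf_geometric)
    also have "\<dots> \<le> p * 2" using p by (intro mult_left_mono) (auto simp: field_simps)
    also have "\<dots> = exp (ln 2 - b' * h x)" by (simp add: p_def exp_diff exp_minus field_simps)
    also have "\<dots> \<le> exp (- (b * h x))"
    proof -
      have "ln 2 \<le> (b' - b) * h x" using elim(4) b' by (simp add: pos_divide_le_eq mult.commute)
      then show ?thesis by (simp add: algebra_simps)
    qed
    finally show ?case .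
  qed
qed

lemma perpetuity_tail_pos:
  fixes R :: "'b \<Rightarrow> real"
  assumes R: "prob_space \<Omega>" "is_perpetuity P M Q \<Omega> R"
  shows "0 < \<P>(\<omega> in \<Omega>. R \<omega> > x)"
proof -
  interpret \<Omega>: prob_space \<Omega> by fact
  have [measurable]: "R \<in> borel_measurable \<Omega>" using R(2) by (simp add: is_perpetuity_def)
  have "AE \<omega> in \<Omega>. 0 \<le> R \<omega>"
    by (rule perpetuity_nonneg[OF prob_space_axioms R(1) M_measurable Q_measurable R(2) AE_M AE_Q])
  then have "\<Omega>.prob {\<omega>\<in>space \<Omega>. 0 \<le> R \<omega>} = 1" by (subst \<Omega>.prob_Collect_eq_1) auto
  moreover have "prob {\<omega>\<in>space P. 0 \<le> M \<omega> \<and> x < Q \<omega>} = prob {\<omega>\<in>space P. x < Q \<omega>}"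
    by (rule finite_measure_eq_AE) (use AE_M in auto)
  moreover have "prob {\<omega>\<in>space P. 0 \<le> M \<omega> \<and> x < Q \<omega>} * \<Omega>.prob {\<omega>\<in>space \<Omega>. 0 \<le> R \<omega>} \<le> \<P>(\<omega> in \<Omega>. R \<omega> > x)"
    by (rule perpetuity_prob_ge[OF prob_space_axioms R(1) M_measurable Q_measurable R(2)])
       (auto simp: add_nonneg_pos add_strict_increasing2)
  ultimately show ?thesis using Q_tail_pos[of x] by simp
qed

lemma perpetuity_log_tail_le:
  fixes R :: "'b \<Rightarrow> real"
  assumes b: "b < c" and R: "prob_space \<Omega>" "is_perpetuity P M Q \<Omega> R"
  shows "\<forall>\<^sub>F x in at_top. ln (\<P>(\<omega> in \<Omega>. R \<omega> > x)) / h_co P M Q x \<le> - b"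
  using perpetuity_tail_le[OF assms] eventually_h_pos
proof eventually_elim
  case (elim x)
  have "ln (\<P>(\<omega> in \<Omega>. R \<omega> > x)) \<le> ln (exp (- (b * h x)))"
    using elim(1) perpetuity_tail_pos[OF R, of x] by (subst ln_le_cancel_iff) auto
  then show ?case using elim(2) by (simp add: h_co_eq pos_divide_le_eq)
qed

section \<open>Lower bound for comonotonic input\<close>

text \<open>
  Inclusion and exclusion: \<open>1 - F - G + min F G = min (1 - F) (1 - G)\<close>.
\<close>
lemma comonotonic_tail:
  assumes "comonotonic P M Q"
  shows "prob {\<omega>\<in>space P. a < M \<omega> \<and> b < Q \<omega>} = min (prob {\<omega>\<in>space P. a < M \<omega>}) (prob {\<omega>\<in>space P. b < Q \<omega>})"
proof -
  define F where "F = prob {\<omega>\<in>space P. M \<omega> \<le> a}"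
  define G where "G = prob {\<omega>\<in>space P. Q \<omega> \<le> b}"
  have "prob {\<omega>\<in>space P. M \<omega> \<le> a \<and> Q \<omega> \<le> b} = min (cdf (distr P borel M) a) (cdf (distr P borel Q) b)"
    using assms unfolding comonotonic_def by blast
  also have "cdf (distr P borel M) a = F"
    unfolding cdf_def F_def by (subst measure_distr) (auto intro!: arg_cong[where f = prob])
  also have "cdf (distr P borel Q) b = G"
    unfolding cdf_def G_def by (subst measure_distr) (auto intro!: arg_cong[where f = prob])
  finally have FG: "prob {\<omega>\<in>space P. M \<omega> \<le> a \<and> Q \<omega> \<le> b} = min F G" .
  have 1: "prob {\<omega>\<in>space P. a < M \<omega>} = 1 - F"
    unfolding F_def by (subst prob_compl[symmetric]) (auto intro!: arg_cong[where f = prob])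
  have 2: "prob {\<omega>\<in>space P. b < Q \<omega>} = 1 - G"
    unfolding G_def by (subst prob_compl[symmetric]) (auto intro!: arg_cong[where f = prob])
  have "prob {\<omega>\<in>space P. a < M \<omega> \<and> b < Q \<omega>}
      = 1 - prob ({\<omega>\<in>space P. M \<omega> \<le> a} \<union> {\<omega>\<in>space P. Q \<omega> \<le> b})"
    by (subst prob_compl[symmetric]) (auto intro!: arg_cong[where f = prob])
  also have "prob ({\<omega>\<in>space P. M \<omega> \<le> a} \<union> {\<omega>\<in>space P. Q \<omega> \<le> b}) = F + G - min F G"
    unfolding F_def G_def FG[unfolded F_def G_def, symmetric]
    by (subst finite_measure_Union') (auto simp: finite_measure_Diff' intro!: arg_cong[where f = prob])
  finally show ?thesis unfolding 1 2 by (auto simp: min_def)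
qed

text \<open>
  Comonotonicity makes the joint tail of \<open>1 / (1 - M)\<close> and \<open>Q\<close> equal to \<open>exp (- max (m t) (k q))\<close>, so
  that the log-tail of \<open>R\<close> satisfies the step inequality of \<open>climbing_cost\<close>.
\<close>
lemma perpetuity_log_tail_ge:
  fixes R :: "'b \<Rightarrow> real"
  assumes co: "comonotonic P M Q" and b: "c < b" and R: "prob_space \<Omega>" "is_perpetuity P M Q \<Omega> R"
  shows "\<forall>\<^sub>F x in at_top. - b \<le> ln (\<P>(\<omega> in \<Omega>. R \<omega> > x)) / h_co P M Q x"
proof -
  interpret \<Omega>: prob_space \<Omega> by fact
  have R_meas[measurable]: "R \<in> borel_measurable \<Omega>" using R(2) by (simp add: is_perpetuity_def)
  note pos = perpetuity_tail_pos[OF R]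
  have "\<forall>\<^sub>F x in at_top. log_tail \<Omega> R x \<le> b * h x"
  proof (rule climbing_cost[OF _ _ b])
    show "mono (log_tail \<Omega> R)" by (rule \<Omega>.mono_log_tail[OF R_meas pos])
    fix y q t :: real assume y: "0 \<le> y" and q: "0 \<le> q" and t: "1 \<le> t"
    define D where "D = max (m t) (k q)"
    have MT: "AE \<omega> in P. t < 1 / (1 - M \<omega>) \<longleftrightarrow> 1 - 1 / t < M \<omega>"
      using AE_M by eventually_elim (use t in \<open>simp add: field_simps\<close>)
    have PM: "prob {\<omega>\<in>space P. 1 - 1 / t < M \<omega>} = prob {\<omega>\<in>space P. t < 1 / (1 - M \<omega>)}"
      by (rule finite_measure_eq_AE) (use MT in auto)
    have "exp (- D) = min (exp (- m t)) (exp (- k q))" by (auto simp: D_def min_def max_def)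
    also have "\<dots> = prob {\<omega>\<in>space P. 1 - 1 / t < M \<omega> \<and> q < Q \<omega>}"
      unfolding comonotonic_tail[OF co] PM by (simp add: exp_minus_log_tail T_tail_pos Q_tail_pos)
    finally have D: "exp (- D) = prob {\<omega>\<in>space P. 1 - 1 / t < M \<omega> \<and> q < Q \<omega>}" .
    have "prob {\<omega>\<in>space P. 1 - 1 / t < M \<omega> \<and> q < Q \<omega>} * \<Omega>.prob {\<omega>\<in>space \<Omega>. y < R \<omega>}
        \<le> \<P>(\<omega> in \<Omega>. R \<omega> > (1 - 1 / t) * y + q)"
    proof (rule perpetuity_prob_ge[OF prob_space_axioms R(1) M_measurable Q_measurable R(2)])
      fix \<omega> \<omega>' assume \<omega>: "\<omega> \<in> {\<omega>\<in>space P. 1 - 1 / t < M \<omega> \<and> q < Q \<omega>}" "\<omega>' \<in> {\<omega>\<in>space \<Omega>. y < R \<omega>}"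
      have "0 \<le> 1 - 1 / t" using t by simp
      then have "0 \<le> M \<omega>" using \<omega> by simp
      then have "(1 - 1 / t) * y \<le> M \<omega> * R \<omega>'" using \<omega> y by (intro mult_mono) auto
      then show "(1 - 1 / t) * y + q < M \<omega> * R \<omega>' + Q \<omega>" using \<omega> by auto
    qed auto
    then have "exp (- D) * exp (- log_tail \<Omega> R y) \<le> exp (- log_tail \<Omega> R ((1 - 1 / t) * y + q))"
      unfolding \<Omega>.exp_minus_log_tail[OF pos] D .
    then have "exp (- D + - log_tail \<Omega> R y) \<le> exp (- log_tail \<Omega> R ((1 - 1 / t) * y + q))"
      by (simp only: exp_add)
    then show "log_tail \<Omega> R ((1 - 1 / t) * y + q) \<le> log_tail \<Omega> R y + max (m t) (k q)"
      by (simp add: D_def)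
  qed
  then show ?thesis
    using eventually_h_pos
    by eventually_elim (simp add: h_co_eq pos_le_divide_eq log_tail_def)
qed

end

section \<open>From the marginals to the log-tails\<close>

lemma measure_distr_eq:
  fixes X\<^sub>1 :: "'a \<Rightarrow> real" and X\<^sub>2 :: "'b \<Rightarrow> real"
  assumes "distr \<Omega>\<^sub>1 borel X\<^sub>1 = distr \<Omega>\<^sub>2 borel X\<^sub>2"
    and "X\<^sub>1 \<in> borel_measurable \<Omega>\<^sub>1" "X\<^sub>2 \<in> borel_measurable \<Omega>\<^sub>2" "{x. S x} \<in> sets borel"
  shows "\<P>(\<omega> in \<Omega>\<^sub>1. S (X\<^sub>1 \<omega>)) = \<P>(\<omega> in \<Omega>\<^sub>2. S (X\<^sub>2 \<omega>))"
proof -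
  have "measure (distr \<Omega>\<^sub>1 borel X\<^sub>1) {x. S x} = \<P>(\<omega> in \<Omega>\<^sub>1. S (X\<^sub>1 \<omega>))"
    using assms(2,4) by (subst measure_distr) (auto intro!: arg_cong[where f = "measure \<Omega>\<^sub>1"])
  moreover have "measure (distr \<Omega>\<^sub>2 borel X\<^sub>2) {x. S x} = \<P>(\<omega> in \<Omega>\<^sub>2. S (X\<^sub>2 \<omega>))"
    using assms(3,4) by (subst measure_distr) (auto intro!: arg_cong[where f = "measure \<Omega>\<^sub>2"])
  ultimately show ?thesis by (simp add: assms(1))
qed

text \<open>
  Since \<open>f x / x\<close> has the positive index \<open>r - 1\<close>, it is unbounded, so that \<open>P(M \<ge> 1) = 0\<close>. The log-tail of
  \<open>1 / (1 - M)\<close> differs from \<open>f x / x\<close> only by an atom and is squeezed between the values of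
  \<open>f x / x\<close> at \<open>x\<close> and at \<open>q * x\<close> for \<open>q > 1\<close>, so that it inherits the index.
\<close>
lemma perpetuity_inputI:
  fixes M Q :: "'a \<Rightarrow> real"
  assumes "prob_space P" and M_meas[measurable]: "M \<in> borel_measurable P" and Q_meas[measurable]: "Q \<in> borel_measurable P"
    and M0: "\<P>(\<omega> in P. 0 \<le> M \<omega>) = 1" and Q0: "\<P>(\<omega> in P. 0 \<le> Q \<omega>) = 1"
    and \<alpha>: "1 < \<alpha>" and r: "1 < r"
    and rv_Q: "regularly_varying \<alpha> (\<lambda>x. - ln (\<P>(\<omega> in P. Q \<omega> > x)))"
    and rv_M: "regularly_varying r (\<lambda>x. - x * ln (\<P>(\<omega> in P. M \<omega> \<ge> 1 - 1 / x)))"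
    and \<gamma>: "\<gamma> = \<alpha> * r / (\<alpha> + r - 1)"
  shows "perpetuity_input P M Q \<alpha> r \<gamma>"
proof -
  interpret prob_space P by fact
  define T where "T \<omega> = 1 / (1 - M \<omega>)" for \<omega>
  have [measurable]: "T \<in> borel_measurable P" unfolding T_def by measurable
  define \<mu> where "\<mu> x = - ln (prob {\<omega>\<in>space P. 1 - 1 / x \<le> M \<omega>})" for x
  have rv0: "regularly_varying (r - 1) (\<lambda>x. - x * ln (prob {\<omega>\<in>space P. 1 - 1 / x \<le> M \<omega>}) / x)"
    by (rule regularly_varying_divide_ident[OF rv_M])
  have \<mu>_eq: "- x * ln (prob {\<omega>\<in>space P. 1 - 1 / x \<le> M \<omega>}) / x = \<mu> x" if "0 < x" for x
    using that by (simp add: \<mu>_def)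
  have \<mu>_pos: "\<forall>\<^sub>F x in at_top. 0 < \<mu> x"
    using regularly_varying_eventually_pos[OF rv0] eventually_gt_at_top[of 0]
    by eventually_elim (simp only: \<mu>_eq)
  have \<mu>_prob: "exp (- \<mu> x) = prob {\<omega>\<in>space P. 1 - 1 / x \<le> M \<omega>}" if "0 < \<mu> x" for x
  proof -
    have "prob {\<omega>\<in>space P. 1 - 1 / x \<le> M \<omega>} \<noteq> 0"
      using that by (intro notI) (simp add: \<mu>_def)
    then have "0 < prob {\<omega>\<in>space P. 1 - 1 / x \<le> M \<omega>}" by (simp add: zero_less_measure_iff)
    then show ?thesis by (simp add: \<mu>_def)
  qed
  have "prob {\<omega>\<in>space P. 1 \<le> M \<omega>} \<le> 0"
  proof (rule field_le_epsilon)
    fix e :: real assume e: "0 < e"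
    obtain x where x: "1 \<le> x" "max 1 (- ln e) \<le> - x * ln (prob {\<omega>\<in>space P. 1 - 1 / x \<le> M \<omega>}) / x"
      using regularly_varying_unbounded[OF rv0, of 1 "max 1 (- ln e)"] r by auto
    then have \<mu>x: "max 1 (- ln e) \<le> \<mu> x" using \<mu>_eq[of x] by simp
    have "prob {\<omega>\<in>space P. 1 \<le> M \<omega>} \<le> prob {\<omega>\<in>space P. 1 - 1 / x \<le> M \<omega>}"
    proof (intro finite_measure_mono subsetI)
      fix \<omega> assume \<omega>: "\<omega> \<in> {\<omega>\<in>space P. 1 \<le> M \<omega>}"
      have "0 \<le> 1 / x" using x by simp
      moreover have "1 \<le> M \<omega>" using \<omega> by simp
      ultimately have "1 - 1 / x \<le> M \<omega>" by linarith
      then show "\<omega> \<in> {\<omega>\<in>space P. 1 - 1 / x \<le> M \<omega>}" using \<omega> by simp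
    qed auto
    also have "\<dots> = exp (- \<mu> x)" using \<mu>x by (intro \<mu>_prob[symmetric]) auto
    also have "\<dots> \<le> exp (ln e)" using \<mu>x by simp
    finally show "prob {\<omega>\<in>space P. 1 \<le> M \<omega>} \<le> 0 + e" using e by simp
  qed
  then have "prob {\<omega>\<in>space P. 1 \<le> M \<omega>} = 0" by (simp add: measure_le_0_iff)
  then have M1: "AE \<omega> in P. \<not> 1 \<le> M \<omega>" by (subst (asm) prob_Collect_eq_0) auto
  have M0': "AE \<omega> in P. 0 \<le> M \<omega>" using M0 by (subst (asm) prob_Collect_eq_1) auto
  have Q0': "AE \<omega> in P. 0 \<le> Q \<omega>" using Q0 by (subst (asm) prob_Collect_eq_1) auto
  have AE_M: "AE \<omega> in P. 0 \<le> M \<omega> \<and> M \<omega> < 1" using M0' M1 by eventually_elim auto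
  have T_ge: "prob {\<omega>\<in>space P. 1 - 1 / y \<le> M \<omega>} \<le> prob {\<omega>\<in>space P. x < T \<omega>}" if "x < y" "0 < y" for x y
  proof (rule finite_measure_mono_AE)
    show "AE \<omega> in P. \<omega> \<in> {\<omega>\<in>space P. 1 - 1 / y \<le> M \<omega>} \<longrightarrow> \<omega> \<in> {\<omega>\<in>space P. x < T \<omega>}"
      using AE_M
    proof eventually_elim
      case (elim \<omega>)
      have "y \<le> T \<omega>" if "1 - 1 / y \<le> M \<omega>" using that elim \<open>0 < y\<close> by (simp add: T_def field_simps)
      then show ?case using \<open>x < y\<close> by auto
    qed
  qed auto
  have T_le: "prob {\<omega>\<in>space P. x < T \<omega>} \<le> prob {\<omega>\<in>space P. 1 - 1 / x \<le> M \<omega>}" if "0 < x" for x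
  proof (rule finite_measure_mono_AE)
    show "AE \<omega> in P. \<omega> \<in> {\<omega>\<in>space P. x < T \<omega>} \<longrightarrow> \<omega> \<in> {\<omega>\<in>space P. 1 - 1 / x \<le> M \<omega>}"
      using AE_M by eventually_elim (use that in \<open>auto simp: T_def field_simps\<close>)
  qed auto
  have T_pos: "0 < prob {\<omega>\<in>space P. x < T \<omega>}" for x
  proof -
    have "\<forall>\<^sub>F y in at_top. 0 < \<mu> y \<and> x < y \<and> 0 < y"
      by (intro eventually_conj \<mu>_pos eventually_gt_at_top)
    then obtain y where y: "0 < \<mu> y" "x < y" "0 < y" by (auto simp: eventually_at_top_linorder)
    have "0 < exp (- \<mu> y)" by simp
    also have "\<dots> \<le> prob {\<omega>\<in>space P. x < T \<omega>}" using T_ge[OF y(2,3)] \<mu>_prob[OF y(1)] by simp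
    finally show ?thesis .
  qed
  have Q_pos: "0 < prob {\<omega>\<in>space P. x < Q \<omega>}" for x
  proof -
    have "\<forall>\<^sub>F y in at_top. 0 < - ln (prob {\<omega>\<in>space P. y < Q \<omega>}) \<and> x \<le> y"
      by (intro eventually_conj regularly_varying_eventually_pos[OF rv_Q] eventually_ge_at_top)
    then obtain y where y: "0 < - ln (prob {\<omega>\<in>space P. y < Q \<omega>})" "x \<le> y"
      by (auto simp: eventually_at_top_linorder)
    then have "prob {\<omega>\<in>space P. y < Q \<omega>} \<noteq> 0" by (intro notI) simp
    then have "0 < prob {\<omega>\<in>space P. y < Q \<omega>}" by (simp add: zero_less_measure_iff)
    also have "\<dots> \<le> prob {\<omega>\<in>space P. x < Q \<omega>}" using y(2) by (intro finite_measure_mono) auto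
    finally show ?thesis .
  qed
  have le1: "\<mu> x \<le> log_tail P T x" if "0 < x" for x
    using T_le[OF that] T_pos[of x] by (simp add: \<mu>_def log_tail_def)
  have le2: "log_tail P T x \<le> \<mu> y" if "x < y" "0 < \<mu> y" "0 < y" for x y
  proof -
    have "exp (- \<mu> y) \<le> prob {\<omega>\<in>space P. x < T \<omega>}" using T_ge[OF that(1,3)] \<mu>_prob[OF that(2)] by simp
    then have "ln (exp (- \<mu> y)) \<le> ln (prob {\<omega>\<in>space P. x < T \<omega>})" using T_pos[of x] by (subst ln_le_cancel_iff) auto
    then show ?thesis by (simp add: log_tail_def)
  qed
  have rv_T: "regularly_varying (r - 1) (log_tail P T)"
  proof (rule regularly_varying_monoI)
    show "mono (log_tail P T)" by (rule mono_log_tail[OF _ T_pos]) simp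
    show "\<forall>\<^sub>F x in at_top. 0 < log_tail P T x"
      using \<mu>_pos eventually_gt_at_top[of 0] by eventually_elim (use le1 in \<open>force intro: less_le_trans\<close>)
    fix s \<epsilon> :: real assume s: "0 < s" and \<epsilon>: "0 < \<epsilon>"
    define q where "q = (1 + \<epsilon>) powr (1 / (2 * (r - 1)))"
    have q: "1 < q" unfolding q_def using \<epsilon> r by (intro gr_one_powr) auto
    have half: "1 / (2 * (r - 1)) * (r - 1) = 1 / 2" using r by (simp add: field_simps)
    have "q powr (r - 1) = (1 + \<epsilon>) powr (1 / 2)" unfolding q_def powr_powr half ..
    also have "\<dots> < (1 + \<epsilon>) powr 1" using \<epsilon> by (intro powr_less_mono) auto
    finally have "q powr (r - 1) * s powr (r - 1) < (1 + \<epsilon>) * s powr (r - 1)"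
      using \<epsilon> s by (intro mult_strict_right_mono) auto
    then have "(q * s) powr (r - 1) < (1 + \<epsilon>) * s powr (r - 1)"
      using q s by (simp add: powr_mult)
    from regularly_varying_eventually_le[OF rv0 _ this]
    have "\<forall>\<^sub>F x in at_top. - (q * s * x) * ln (prob {\<omega>\<in>space P. 1 - 1 / (q * s * x) \<le> M \<omega>}) / (q * s * x)
        \<le> (1 + \<epsilon>) * s powr (r - 1) * (- x * ln (prob {\<omega>\<in>space P. 1 - 1 / x \<le> M \<omega>}) / x)"
      using q s by simp
    moreover have "\<forall>\<^sub>F x in at_top. 0 < \<mu> ((q * s) * x)"
      using q s by (intro eventually_at_top_scale \<mu>_pos) auto
    ultimately show "\<forall>\<^sub>F x in at_top. log_tail P T (s * x) \<le> (1 + \<epsilon>) * s powr (r - 1) * log_tail P T x"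
      using eventually_gt_at_top[of 0]
    proof eventually_elim
      case (elim x)
      have qsx: "0 < q * s * x" using q s elim by simp
      have "1 * (s * x) < q * (s * x)" using q s elim by (intro mult_strict_right_mono) auto
      then have "log_tail P T (s * x) \<le> \<mu> (q * s * x)"
        using elim qsx by (intro le2) (auto simp: mult.assoc)
      also have "\<dots> \<le> (1 + \<epsilon>) * s powr (r - 1) * \<mu> x"
        using elim(1) unfolding \<mu>_eq[OF qsx] \<mu>_eq[OF elim(3)] .
      also have "\<dots> \<le> (1 + \<epsilon>) * s powr (r - 1) * log_tail P T x"
        using le1[OF elim(3)] \<epsilon> by (intro mult_left_mono) auto
      finally show ?case .
    qed
  qed
  show ?thesis
    by unfold_locales
      (use AE_M Q0' \<alpha> r T_pos Q_pos rv_T rv_Q \<gamma> in \<open>simp_all add: T_def[abs_def] log_tail_def[abs_def]\<close>)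
qed

lemma Limsup_le_of_eventually_le:
  fixes f :: "real \<Rightarrow> real"
  assumes "\<And>b. b < c \<Longrightarrow> \<forall>\<^sub>F x in at_top. f x \<le> - b"
  shows "Limsup at_top (\<lambda>x. ereal (f x)) \<le> ereal (- c)"
proof (rule ereal_le_epsilon2)
  fix e :: real assume "0 < e"
  then have "\<forall>\<^sub>F x in at_top. f x \<le> - (c - e)" by (intro assms) simp
  then have "\<forall>\<^sub>F x in at_top. ereal (f x) \<le> ereal (- c) + ereal e" by eventually_elim simp
  then show "Limsup at_top (\<lambda>x. ereal (f x)) \<le> ereal (- c) + ereal e" by (rule Limsup_bounded)
qed

theorem theorem6p1:
  fixes \<Omega> :: "'a measure" and M Q :: "'a \<Rightarrow> real"
    and \<Omega>\<^sub>R :: "'b measure" and R :: "'b \<Rightarrow> real"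
    and \<Omega>\<^sub>c\<^sub>o :: "'c measure" and M\<^sub>c\<^sub>o Q\<^sub>c\<^sub>o :: "'c \<Rightarrow> real"
    and \<Omega>\<^sub>R\<^sub>c\<^sub>o :: "'d measure" and R\<^sub>c\<^sub>o :: "'d \<Rightarrow> real"
    and \<alpha> r \<beta> rstar \<gamma> :: real
  assumes "prob_space \<Omega>" "prob_space \<Omega>\<^sub>R" "prob_space \<Omega>\<^sub>c\<^sub>o" "prob_space \<Omega>\<^sub>R\<^sub>c\<^sub>o"
    and "M \<in> borel_measurable \<Omega>" "Q \<in> borel_measurable \<Omega>"
    and "\<P>(\<omega> in \<Omega>. M \<omega> \<ge> 0 \<and> Q \<omega> \<ge> 0) = 1"
    and "\<alpha> > 1" "r > 1"
    and "regularly_varying \<alpha> (\<lambda>x. - ln (\<P>(\<omega> in \<Omega>. Q \<omega> > x)))"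
    and "regularly_varying r (\<lambda>x. - x * ln (\<P>(\<omega> in \<Omega>. M \<omega> \<ge> 1 - 1 / x)))"
    and "1 / r + 1 / rstar = 1" "1 / \<alpha> + 1 / \<beta> = 1"
    and "\<gamma> = \<beta> * rstar / (\<beta> * rstar - 1)"
    and "is_perpetuity \<Omega> M Q \<Omega>\<^sub>R R"
    and "comonotonic \<Omega>\<^sub>c\<^sub>o M\<^sub>c\<^sub>o Q\<^sub>c\<^sub>o"
    and "distr \<Omega>\<^sub>c\<^sub>o borel M\<^sub>c\<^sub>o = distr \<Omega> borel M"
    and "distr \<Omega>\<^sub>c\<^sub>o borel Q\<^sub>c\<^sub>o = distr \<Omega> borel Q"
    and "is_perpetuity \<Omega>\<^sub>c\<^sub>o M\<^sub>c\<^sub>o Q\<^sub>c\<^sub>o \<Omega>\<^sub>R\<^sub>c\<^sub>o R\<^sub>c\<^sub>o"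
  shows "Limsup at_top (\<lambda>x. ereal (ln (\<P>(\<omega> in \<Omega>\<^sub>R. R \<omega> > x)) / h_co \<Omega> M Q x))
           \<le> ereal (- ((\<gamma> / (\<gamma> - 1)) powr (\<gamma> - 1)))
       \<and> ((\<lambda>x. ln (\<P>(\<omega> in \<Omega>\<^sub>R\<^sub>c\<^sub>o. R\<^sub>c\<^sub>o \<omega> > x)) / h_co \<Omega> M Q x)
            \<longlongrightarrow> - ((\<gamma> / (\<gamma> - 1)) powr (\<gamma> - 1))) at_top"
proof -
  interpret \<Omega>: prob_space \<Omega> by fact
  interpret \<Omega>co: prob_space \<Omega>\<^sub>c\<^sub>o by fact
  have [measurable]: "M \<in> borel_measurable \<Omega>" "Q \<in> borel_measurable \<Omega>" by fact+
  have [measurable]: "M\<^sub>c\<^sub>o \<in> borel_measurable \<Omega>\<^sub>c\<^sub>o" "Q\<^sub>c\<^sub>o \<in> borel_measurable \<Omega>\<^sub>c\<^sub>o"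
    using \<open>comonotonic \<Omega>\<^sub>c\<^sub>o M\<^sub>c\<^sub>o Q\<^sub>c\<^sub>o\<close> by (simp_all add: comonotonic_def)
  have M_co: "\<P>(\<omega> in \<Omega>\<^sub>c\<^sub>o. S (M\<^sub>c\<^sub>o \<omega>)) = \<P>(\<omega> in \<Omega>. S (M \<omega>))" if "{x. S x} \<in> sets borel" for S
    by (rule measure_distr_eq[where S = S, OF assms(17) _ _ that]) measurable
  have Q_co: "\<P>(\<omega> in \<Omega>\<^sub>c\<^sub>o. S (Q\<^sub>c\<^sub>o \<omega>)) = \<P>(\<omega> in \<Omega>. S (Q \<omega>))" if "{x. S x} \<in> sets borel" for S
    by (rule measure_distr_eq[where S = S, OF assms(18) _ _ that]) measurable
  have "\<P>(\<omega> in \<Omega>. 0 \<le> M \<omega> \<and> 0 \<le> Q \<omega>) \<le> \<P>(\<omega> in \<Omega>. 0 \<le> M \<omega>)"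
       "\<P>(\<omega> in \<Omega>. 0 \<le> M \<omega> \<and> 0 \<le> Q \<omega>) \<le> \<P>(\<omega> in \<Omega>. 0 \<le> Q \<omega>)"
    by (intro \<Omega>.finite_measure_mono; auto)+
  then have M0: "\<P>(\<omega> in \<Omega>. 0 \<le> M \<omega>) = 1" and Q0: "\<P>(\<omega> in \<Omega>. 0 \<le> Q \<omega>) = 1"
    using \<open>\<P>(\<omega> in \<Omega>. 0 \<le> M \<omega> \<and> 0 \<le> Q \<omega>) = 1\<close> by (auto intro!: antisym)
  have "rstar \<noteq> 0" using \<open>1 / r + 1 / rstar = 1\<close> \<open>1 < r\<close> by (intro notI) simp
  then have rstar: "rstar = r / (r - 1)"
    using \<open>1 / r + 1 / rstar = 1\<close> \<open>1 < r\<close> by (simp add: field_simps)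
  have "\<beta> \<noteq> 0" using \<open>1 / \<alpha> + 1 / \<beta> = 1\<close> \<open>1 < \<alpha>\<close> by (intro notI) simp
  then have \<beta>: "\<beta> = \<alpha> / (\<alpha> - 1)"
    using \<open>1 / \<alpha> + 1 / \<beta> = 1\<close> \<open>1 < \<alpha>\<close> by (simp add: field_simps)
  have \<gamma>: "\<gamma> = \<alpha> * r / (\<alpha> + r - 1)"
  proof -
    define u where "u = (\<alpha> - 1) * (r - 1)"
    have u: "0 < u" using \<open>1 < \<alpha>\<close> \<open>1 < r\<close> by (simp add: u_def)
    have "\<beta> * rstar = \<alpha> * r / u" by (simp add: \<beta> rstar u_def)
    moreover have "\<alpha> * r / u - 1 = (\<alpha> + r - 1) / u" using u by (simp add: u_def field_simps)
    ultimately show ?thesis using assms(14) u by simp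
  qed
  interpret I: perpetuity_input \<Omega> M Q \<alpha> r \<gamma>
    by (rule perpetuity_inputI) (use assms M0 Q0 \<gamma> in auto)
  interpret Ico: perpetuity_input \<Omega>\<^sub>c\<^sub>o M\<^sub>c\<^sub>o Q\<^sub>c\<^sub>o \<alpha> r \<gamma>
    by (rule perpetuity_inputI) (use assms M0 Q0 \<gamma> in \<open>simp_all add: M_co Q_co\<close>)
  have h: "h_co \<Omega>\<^sub>c\<^sub>o M\<^sub>c\<^sub>o Q\<^sub>c\<^sub>o = h_co \<Omega> M Q"
    unfolding h_co_def[abs_def] by (subst M_co, measurable) (subst Q_co, measurable)
  have c: "(\<gamma> / (\<gamma> - 1)) powr (\<gamma> - 1) = I.c" "I.c = Ico.c"
    by (simp_all add: I.c_def I.\<zeta>_def)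
  have "Limsup at_top (\<lambda>x. ereal (ln (\<P>(\<omega> in \<Omega>\<^sub>R. R \<omega> > x)) / h_co \<Omega> M Q x)) \<le> ereal (- I.c)"
    by (intro Limsup_le_of_eventually_le I.perpetuity_log_tail_le assms)
  moreover have "((\<lambda>x. ln (\<P>(\<omega> in \<Omega>\<^sub>R\<^sub>c\<^sub>o. R\<^sub>c\<^sub>o \<omega> > x)) / h_co \<Omega>\<^sub>c\<^sub>o M\<^sub>c\<^sub>o Q\<^sub>c\<^sub>o x) \<longlongrightarrow> - I.c) at_top"
  proof (rule order_tendstoI)
    fix a assume "a < - I.c"
    then obtain b where b: "a < - b" "Ico.c < b" using dense[of a "- I.c"] c by (metis minus_less_iff minus_minus)
    from Ico.perpetuity_log_tail_ge[OF _ b(2), of \<Omega>\<^sub>R\<^sub>c\<^sub>o R\<^sub>c\<^sub>o]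
    have "\<forall>\<^sub>F x in at_top. - b \<le> ln (\<P>(\<omega> in \<Omega>\<^sub>R\<^sub>c\<^sub>o. R\<^sub>c\<^sub>o \<omega> > x)) / h_co \<Omega>\<^sub>c\<^sub>o M\<^sub>c\<^sub>o Q\<^sub>c\<^sub>o x"
      using assms by blast
    then show "\<forall>\<^sub>F x in at_top. a < ln (\<P>(\<omega> in \<Omega>\<^sub>R\<^sub>c\<^sub>o. R\<^sub>c\<^sub>o \<omega> > x)) / h_co \<Omega>\<^sub>c\<^sub>o M\<^sub>c\<^sub>o Q\<^sub>c\<^sub>o x"
      by eventually_elim (use b in linarith)
  next
    fix a assume "- I.c < a"
    then obtain b where b: "- b < a" "b < Ico.c" using dense[of "- I.c" a] c by (metis minus_less_iff minus_minus)
    from Ico.perpetuity_log_tail_le[OF b(2), of \<Omega>\<^sub>R\<^sub>c\<^sub>o R\<^sub>c\<^sub>o]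
    have "\<forall>\<^sub>F x in at_top. ln (\<P>(\<omega> in \<Omega>\<^sub>R\<^sub>c\<^sub>o. R\<^sub>c\<^sub>o \<omega> > x)) / h_co \<Omega>\<^sub>c\<^sub>o M\<^sub>c\<^sub>o Q\<^sub>c\<^sub>o x \<le> - b"
      using assms by blast
    then show "\<forall>\<^sub>F x in at_top. ln (\<P>(\<omega> in \<Omega>\<^sub>R\<^sub>c\<^sub>o. R\<^sub>c\<^sub>o \<omega> > x)) / h_co \<Omega>\<^sub>c\<^sub>o M\<^sub>c\<^sub>o Q\<^sub>c\<^sub>o x < a"
      by eventually_elim (use b in linarith)
  qed
  ultimately show ?thesis unfolding c(1) h by blast
qed

end
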